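(* Let $\phi_1,\dots,\phi_n:\mathbb{R}^{n-1}\to\mathbb{R}$ be smooth. For each $\sigma\in\mathbb{R}$, $$\int_{x_1+\cdots+x_n=0}|T_\sigma(g_1,\dots,g_n)(x_1,\dots,x_n)|^2\,dx=(2\pi)^{n(n-1)}\int_{(\mathbb{R}^{n-1})^n}\frac{|g_1(\xi_1)|^2\cdots|g_n(\xi_n)|^2}{\left|\det\begin{pmatrix}1&\cdots&1\\ \nabla\phi_1(\xi_1)&\cdots&\nabla\phi_n(\xi_n)\end{pmatrix}\right|^{1-2\sigma}}\,d\xi$$ for all functions $g_1,\dots,g_n$ (a priori in $L^1(\mathbb{R}^{n-1})$) such that the determinant factor is nonzero whenever $\xi_j$ belongs to the convex hull of the support of $g_j$, $1\le j\le n$.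
   Context: Here $n\ge 2$ and $\xi=(\xi_1,\dots,\xi_n)\in(\mathbb{R}^{n-1})^n$. For $x_1,\dots,x_n\in\mathbb{R}^n$, with $x_j=(x_j',x_{jn})\in\mathbb{R}^{n-1}\times\mathbb{R}$, the multilinear operator $T_\sigma$ is $$T_\sigma(g_1,\dots,g_n)(x_1,\dots,x_n)=\int_{(\mathbb{R}^{n-1})^n}\left|\det\begin{pmatrix}1&\cdots&1\\ \nabla\phi_1(\xi_1)&\cdots&\nabla\phi_n(\xi_n)\end{pmatrix}\right|^\sigma\prod_{j=1}^n e^{i(x_j'\cdot\xi_j+x_{jn}\phi_j(\xi_j))}g_j(\xi_j)\,d\xi_j .$$ The matrix is the $n\times n$ matrix with $j$-th column $(1,\nabla\phi_j(\xi_j))^T$. The integral over $x_1+\cdots+x_n=0$ means $\int_{(\mathbb{R}^n)^{n-1}}|T_\sigma(g_1,\dots,g_n)(x_1,\dots,x_{n-1},-x_1-\cdots-x_{n-1})|^2\,dx_1\cdots dx_{n-1}$.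
   Formalization: The formal theorem also assumes that the integral defining T_σ(g_1,…,g_n)(x) converges absolutely, which g_j ∈ L¹ alone does not guarantee when σ ≠ 0 (the determinant may be unbounded or approach zero on the supports). *)

theory Defs
  imports "HOL-Analysis.Analysis"
begin

text \<open>
  The space \<open>\<real>\<^sup>n\<^sup>-\<^sup>1\<close> is \<open>real^'m\<close>, so \<open>n - 1 = CARD('m) \<ge> 1\<close>. The indices \<open>1, \<dots>, n\<close> are the
  elements of \<open>'m option\<close>, with \<open>None\<close> in the role of the distinguished index \<open>n\<close>; the same
  type indexes the rows of the determinant, where \<open>None\<close> is the row of ones. A point of
  \<open>\<real>\<^sup>n = \<real>\<^sup>n\<^sup>-\<^sup>1 \<times> \<real>\<close> is a pair \<open>(x', x\<^sub>n)\<close>.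
\<close>

fun Ck :: "nat \<Rightarrow> ('a::euclidean_space \<Rightarrow> real) \<Rightarrow> bool" where
  "Ck 0 f \<longleftrightarrow> continuous_on UNIV f"
| "Ck (Suc k) f \<longleftrightarrow> (\<forall>x. f differentiable at x) \<and>
     (\<forall>b\<in>Basis. Ck k (\<lambda>x. frechet_derivative f (at x) b))"

definition smooth :: "('a::euclidean_space \<Rightarrow> real) \<Rightarrow> bool" where
  "smooth f \<longleftrightarrow> (\<forall>k. Ck k f)"

definition grad :: "(real^'m \<Rightarrow> real) \<Rightarrow> real^'m \<Rightarrow> real^'m" where
  "grad f x = (\<chi> i. frechet_derivative f (at x) (axis i 1))"

text \<open>
  Elements of \<open>L\<^sup>1\<close> are only determined almost everywhere, so their support is the closed
  measure-theoretic one: the complement of the largest open set on which the function vanishes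
  almost everywhere. It is contained in \<open>closure {x. f x \<noteq> 0}\<close>, with equality for continuous \<open>f\<close>.
\<close>

definition ess_support :: "('a::euclidean_space \<Rightarrow> 'b::zero) \<Rightarrow> 'a set" where
  "ess_support f = - \<Union>{U. open U \<and> (AE x in lebesgue. x \<in> U \<longrightarrow> f x = 0)}"

definition grad_det ::
  "('m::finite option \<Rightarrow> real^'m \<Rightarrow> real) \<Rightarrow> (real^'m)^('m option) \<Rightarrow> real" where
  "grad_det \<phi> \<xi> =
     det (\<chi> i j. (case i of None \<Rightarrow> 1 | Some k \<Rightarrow> grad (\<phi> j) (\<xi> $ j) $ k)
            :: real^('m option)^('m option))"

definition T_integrand ::
  "real \<Rightarrow> ('m::finite option \<Rightarrow> real^'m \<Rightarrow> real) \<Rightarrow> ('m option \<Rightarrow> real^'m \<Rightarrow> complex) \<Rightarrow>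
   ((real^'m) \<times> real)^('m option) \<Rightarrow> (real^'m)^('m option) \<Rightarrow> complex" where
  "T_integrand \<sigma> \<phi> g x \<xi> =
     complex_of_real (\<bar>grad_det \<phi> \<xi>\<bar> powr \<sigma>) *
     (\<Prod>j\<in>UNIV. exp (\<i> * complex_of_real (fst (x $ j) \<bullet> \<xi> $ j + snd (x $ j) * \<phi> j (\<xi> $ j)))
               * g j (\<xi> $ j))"

definition T_op ::
  "real \<Rightarrow> ('m::finite option \<Rightarrow> real^'m \<Rightarrow> real) \<Rightarrow> ('m option \<Rightarrow> real^'m \<Rightarrow> complex) \<Rightarrow>
   ((real^'m) \<times> real)^('m option) \<Rightarrow> complex" where
  "T_op \<sigma> \<phi> g x = (\<integral>\<xi>. T_integrand \<sigma> \<phi> g x \<xi> \<partial>lebesgue)"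

text \<open>The point \<open>(x\<^sub>1, \<dots>, x\<^sub>n\<^sub>-\<^sub>1, -x\<^sub>1 - \<dots> - x\<^sub>n\<^sub>-\<^sub>1)\<close> of the subspace \<open>x\<^sub>1 + \<dots> + x\<^sub>n = 0\<close>.\<close>

definition zero_sum_point ::
  "((real^'m) \<times> real)^'m \<Rightarrow> ((real^'m) \<times> real)^('m::finite option)" where
  "zero_sum_point y = (\<chi> j. case j of Some k \<Rightarrow> y $ k | None \<Rightarrow> - (\<Sum>k\<in>UNIV. y $ k))"

end

theory Submission
  imports Defs "HOL-Probability.Characteristic_Functions"
begin

text \<open>
  On \<open>x\<^sub>1 + \<dots> + x\<^sub>n = 0\<close> the operator is the Fourier transform of the push-forward of
  \<open>\<bar>det\<bar>\<^sup>\<sigma> \<Prod>\<^sub>j g\<^sub>j\<close> under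
  \<open>\<Phi>(\<xi>) = (\<xi>\<^sub>k - \<xi>\<^sub>n, \<phi>\<^sub>k(\<xi>\<^sub>k) - \<phi>\<^sub>n(\<xi>\<^sub>n))\<^sub>k\<^sub><\<^sub>n\<close>. The Jacobian determinant of \<open>\<Phi>\<close> is, up to sign, the
  determinant in the statement. If \<open>\<Phi>(\<xi>) = \<Phi>(\<eta>)\<close> then all \<open>\<xi>\<^sub>j - \<eta>\<^sub>j\<close> equal one vector \<open>v\<close> and all
  \<open>\<phi>\<^sub>j(\<xi>\<^sub>j) - \<phi>\<^sub>j(\<eta>\<^sub>j)\<close> equal one number, so the mean value theorem on the segments from \<open>\<eta>\<^sub>j\<close> to \<open>\<xi>\<^sub>j\<close>
  makes \<open>\<nabla>\<phi>\<^sub>j(\<zeta>\<^sub>j) \<bullet> v\<close> independent of \<open>j\<close>; nonvanishing of the determinant on the convex hulls forces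
  \<open>v = 0\<close>. Hence \<open>\<Phi>\<close> is injective where it matters, the push-forward has the density
  \<open>\<bar>det\<bar>\<^bsup>\<sigma> - 1\<^esup> \<Prod>\<^sub>j g\<^sub>j\<close>, and Plancherel's theorem together with the change of variables back to \<open>\<xi>\<close> gives
  the identity. Plancherel is needed for all of \<open>L\<^sup>1\<close>, both sides being possibly infinite.
\<close>

section \<open>Plancherel's theorem\<close>

text \<open>For \<open>F\<close> merely in L^1 the square of the transform need not be integrable,
  so it cannot be expanded into a double integral directly. A Gaussian weight in \<open>y\<close>
  makes the expansion absolutely convergent and turns the integral into the squared norm of a
  Gaussian average of \<open>F\<close>. The weight is removed by Fatou's lemma in both directions,
  in \<open>ennreal\<close>, so divergent integrals need no separate treatment.

  The intermediate points of the mean value theorem may leave the supports, hence the hulls. The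
  push-forward itself lives on the product of the supports; that this set is closed keeps the images
  of its Borel subsets Borel, so the density on the image is measurable.

  The power of \<open>2 * pi\<close> is the dimension \<open>n * (n - 1)\<close> of the space in
  which \<Phi> takes its values. The exponent \<open>1 - 2 * \<sigma>\<close> arises because the
  squared weight contributes the power \<open>2 * \<sigma>\<close> of the determinant and the
  Jacobian divides by one further factor.\<close>

lemma
  fixes f :: "'a::euclidean_space \<Rightarrow> real \<Rightarrow> complex"
  assumes f: "\<And>b. b \<in> Basis \<Longrightarrow> integrable lborel (f b)"
  shows integrable_lborel_prod: "integrable lborel (\<lambda>x. \<Prod>b\<in>Basis. f b (x \<bullet> b))"
    and integral_lborel_prod:
      "(\<integral>x. (\<Prod>b\<in>Basis. f b (x \<bullet> b)) \<partial>lborel) = (\<Prod>b\<in>Basis. \<integral>t. f b t \<partial>lborel)"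
proof -
  interpret product_sigma_finite "\<lambda>_::'a. lborel :: real measure"
    by standard
  have [measurable]: "\<And>b. b \<in> Basis \<Longrightarrow> f b \<in> borel_measurable borel"
    using f by auto
  have comp: "(\<Prod>b\<in>Basis. f b ((\<Sum>c\<in>Basis. y c *\<^sub>R c) \<bullet> b)) = (\<Prod>b\<in>Basis. f b (y b))" for y :: "'a \<Rightarrow> real"
    by (intro prod.cong refl) simp
  have [measurable]: "(\<lambda>x. \<Prod>b\<in>Basis. f b (x \<bullet> b)) \<in> borel_measurable borel"
    by measurable
  \<comment> \<open>\<open>lborel_eq\<close> presents Lebesgue measure as the image of the product
    of its one-dimensional copies, so both claims become the Fubini facts for finite
    products.\<close>
  show "integrable lborel (\<lambda>x. \<Prod>b\<in>Basis. f b (x \<bullet> b))"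
    by (subst lborel_eq, subst integrable_distr_eq)
       (simp_all only: comp, simp_all add: product_integrable_prod f)
  show "(\<integral>x. (\<Prod>b\<in>Basis. f b (x \<bullet> b)) \<partial>lborel) = (\<Prod>b\<in>Basis. \<integral>t. f b t \<partial>lborel)"
    by (subst lborel_eq, subst integral_distr)
       (simp_all only: comp, simp_all add: product_integral_prod f)
qed

text \<open>The characteristic function of the standard normal distribution under the substitution
  \<open>s = r * t\<close>: the frequency becomes \<open>w / r\<close>, and the prefactor combines
  the constant of the density with the Jacobian \<open>r\<close>.\<close>

lemma gaussian_fourier_real:
  fixes r w :: real
  assumes r: "r > 0"
  shows "has_bochner_integral lborel
    (\<lambda>t. exp (\<i> * complex_of_real (t * w)) * complex_of_real (exp (- (r * t)\<^sup>2 / 2)))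
    (complex_of_real (sqrt (2 * pi) / r * exp (- (w / r)\<^sup>2 / 2)))"
proof -
  interpret std: real_distribution std_normal_distribution
    by (rule real_dist_normal_dist)
  let ?f = "\<lambda>s. std_normal_density s *\<^sub>R iexp (w / r * s)"
  have int: "integrable lborel ?f"
  proof -
    have "integrable std_normal_distribution (\<lambda>s. iexp (w / r * s))"
      by (rule std.integrable_iexp) auto
    then show ?thesis
      by (subst (asm) integrable_density) (auto simp: normal_density_nonneg)
  qed
  have "integral\<^sup>L lborel ?f = char std_normal_distribution (w / r)"
    unfolding char_def by (subst integral_density) (auto simp: normal_density_nonneg)
  then have "has_bochner_integral lborel ?f (complex_of_real (exp (- (w / r)\<^sup>2 / 2)))"
    using int by (simp add: has_bochner_integral_iff char_std_normal_distribution)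
  then have "has_bochner_integral lborel (\<lambda>t. ?f (0 + r * t))
     (complex_of_real (exp (- (w / r)\<^sup>2 / 2)) /\<^sub>R \<bar>r\<bar>)"
    using r by (subst (asm) lborel_has_bochner_integral_real_affine_iff[of r _ _ 0]) auto
  then have "has_bochner_integral lborel (\<lambda>t. sqrt (2 * pi) *\<^sub>R ?f (0 + r * t))
     (sqrt (2 * pi) *\<^sub>R (complex_of_real (exp (- (w / r)\<^sup>2 / 2)) /\<^sub>R \<bar>r\<bar>))"
    by (rule has_bochner_integral_scaleR_right)
  then show ?thesis
    using r by (simp add: std_normal_density_def scaleR_conv_of_real field_simps)
qed

text \<open>The Gaussian and the exponential both factor over the coordinates, which reduces the
  claim to dimension one.\<close>

lemma gaussian_fourier:
  fixes w :: "'a::euclidean_space"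
  assumes r: "r > 0"
  shows "has_bochner_integral lborel
    (\<lambda>x. exp (\<i> * complex_of_real (x \<bullet> w)) * complex_of_real (exp (- (r * norm x)\<^sup>2 / 2)))
    (complex_of_real ((sqrt (2 * pi) / r) ^ DIM('a) * exp (- (norm w / r)\<^sup>2 / 2)))"
proof -
  let ?f = "\<lambda>b t. exp (\<i> * complex_of_real (t * (w \<bullet> b))) * complex_of_real (exp (- (r * t)\<^sup>2 / 2))"
  have norm2: "(norm x)\<^sup>2 = (\<Sum>b\<in>Basis. (x \<bullet> b)\<^sup>2)" for x :: 'a
    by (subst power2_norm_eq_inner, subst euclidean_inner) (simp add: power2_eq_square)
  have fac: "(\<Prod>b\<in>Basis. ?f b (x \<bullet> b)) =
      exp (\<i> * complex_of_real (x \<bullet> w)) * complex_of_real (exp (- (r * norm x)\<^sup>2 / 2))" for x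
  proof -
    have "(\<Sum>b\<in>Basis. \<i> * complex_of_real ((x \<bullet> b) * (w \<bullet> b))) = \<i> * complex_of_real (x \<bullet> w)"
      by (subst euclidean_inner[of x w]) (simp add: sum_distrib_left)
    moreover have "(\<Sum>b\<in>Basis. - (r * (x \<bullet> b))\<^sup>2 / 2) = - (r * norm x)\<^sup>2 / 2"
      by (simp add: power_mult_distrib norm2 sum_distrib_left sum_divide_distrib sum_negf)
    ultimately show ?thesis
      by (simp add: prod.distrib flip: exp_sum of_real_prod)
  qed
  have ints: "(\<Prod>b\<in>Basis. complex_of_real (sqrt (2 * pi) / r * exp (- ((w \<bullet> b) / r)\<^sup>2 / 2))) =
      complex_of_real ((sqrt (2 * pi) / r) ^ DIM('a) * exp (- (norm w / r)\<^sup>2 / 2))"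
  proof -
    have "(\<Sum>b\<in>Basis. - ((w \<bullet> b) / r)\<^sup>2 / 2) = - (norm w / r)\<^sup>2 / 2"
      by (simp add: power_divide norm2 sum_divide_distrib sum_negf)
    then show ?thesis
      by (simp only: of_real_prod[symmetric] prod.distrib prod_constant exp_sum[OF finite_Basis, symmetric])
  qed
  note 1 = gaussian_fourier_real[OF r, unfolded has_bochner_integral_iff]
  show ?thesis
    using integrable_lborel_prod[of ?f, OF 1[THEN conjunct1]]
      integral_lborel_prod[of ?f, OF 1[THEN conjunct1]] 1[THEN conjunct2]
    unfolding has_bochner_integral_iff fac by (simp only: ints)
qed

lemma gaussian_integral:
  assumes r: "r > 0"
  shows "has_bochner_integral lborel (\<lambda>x::'a::euclidean_space. exp (- (r * norm x)\<^sup>2 / 2))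
    ((sqrt (2 * pi) / r) ^ DIM('a))"
proof -
  have "has_bochner_integral lborel (\<lambda>x::'a. Re (complex_of_real (exp (- (r * norm x)\<^sup>2 / 2))))
      (Re (complex_of_real ((sqrt (2 * pi) / r) ^ DIM('a))))"
    using gaussian_fourier[OF r, of "0::'a"]
    by (intro has_bochner_integral_Re) (simp del: of_real_exp of_real_power of_real_divide)
  then show ?thesis
    by (simp only: Re_complex_of_real)
qed

section \<open>Expanding the square of an integral operator\<close>

lemma
  fixes f g :: "_ \<Rightarrow> complex"
  assumes f: "integrable lborel f" and g: "integrable lborel g"
  shows integrable_lborel_pair: "integrable (lborel \<Otimes>\<^sub>M lborel) (\<lambda>p. f (fst p) * g (snd p))"
    and integral_lborel_pair:
      "(\<integral>p. f (fst p) * g (snd p) \<partial>(lborel \<Otimes>\<^sub>M lborel)) = (\<integral>u. f u \<partial>lborel) * (\<integral>v. g v \<partial>lborel)"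
proof -
  have [measurable]: "f \<in> borel_measurable borel" "g \<in> borel_measurable borel"
    using f g by auto
  show int: "integrable (lborel \<Otimes>\<^sub>M lborel) (\<lambda>p. f (fst p) * g (snd p))"
    by (rule lborel_pair.Fubini_integrable) (use f g in \<open>auto simp: norm_mult\<close>)
  show "(\<integral>p. f (fst p) * g (snd p) \<partial>(lborel \<Otimes>\<^sub>M lborel)) = (\<integral>u. f u \<partial>lborel) * (\<integral>v. g v \<partial>lborel)"
    by (subst lborel_pair.integral_fst'[OF int, symmetric]) simp
qed

text \<open>The square is expanded into a double integral over \<open>u\<close> and
  \<open>v\<close>, and \<open>y\<close> is integrated out first. The bound by 1 makes each inner
  integral exist; the uniform bound \<open>C\<close> makes the integral over all three variables
  converge absolutely, as Fubini requires.\<close>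

lemma
  fixes a :: "'y::euclidean_space \<Rightarrow> 'u::euclidean_space \<Rightarrow> complex" and F :: "'u \<Rightarrow> complex"
  assumes F: "integrable lborel F"
    and a [measurable]: "(\<lambda>p. a (fst p) (snd p)) \<in> borel_measurable borel"
    and bound: "\<And>y u. cmod (a y u) \<le> 1"
    and square: "\<And>u. (\<integral>\<^sup>+y. ennreal ((cmod (a y u))\<^sup>2) \<partial>lborel) \<le> ennreal C"
  shows integrable_kernel_square: "integrable lborel (\<lambda>y. (cmod (\<integral>u. F u * a y u \<partial>lborel))\<^sup>2)"
    and integral_kernel_square: "complex_of_real (\<integral>y. (cmod (\<integral>u. F u * a y u \<partial>lborel))\<^sup>2 \<partial>lborel) =
      (\<integral>p. F (fst p) * cnj (F (snd p)) * (\<integral>y. a y (fst p) * cnj (a y (snd p)) \<partial>lborel)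
         \<partial>(lborel \<Otimes>\<^sub>M lborel))"
proof -
  have [measurable]: "cnj \<in> borel_measurable borel"
    by (intro borel_measurable_continuous_onI continuous_intros)
  have Fm [measurable]: "F \<in> borel_measurable borel"
    using F by auto
  have am [measurable]: "(\<lambda>x. a (f x) (h x)) \<in> borel_measurable M"
    if "f \<in> borel_measurable M" "h \<in> borel_measurable M" for f h and M :: "'c measure"
    using measurable_compose[OF _ a, of "\<lambda>x. (f x, h x)" M] that by (simp add: borel_prod[symmetric])
  define P where "P = (lborel \<Otimes>\<^sub>M lborel :: ('u \<times> 'u) measure)"
  have P: "P = lborel"
    by (simp add: P_def lborel_prod)
  interpret P: pair_sigma_finite "lborel :: 'y measure" P
    unfolding P by standard
  define Q where "Q = (\<lambda>(y, p). (F (fst p) * a y (fst p)) * cnj (F (snd p) * a y (snd p)))"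
  have Qm [measurable]: "Q \<in> borel_measurable (lborel \<Otimes>\<^sub>M P)"
    unfolding Q_def P_def by measurable
  \<comment> \<open>AM-GM gives a bound independent of \<open>u\<close> and \<open>v\<close>, so the
    integrability of \<open>Q\<close> reduces to that of \<open>F u * cnj (F v)\<close>.\<close>
  have C: "(\<integral>\<^sup>+y. ennreal (cmod (a y u) * cmod (a y v)) \<partial>lborel) \<le> ennreal C + ennreal C" for u v
  proof -
    have "cmod (a y u) * cmod (a y v) \<le> (cmod (a y u))\<^sup>2 + (cmod (a y v))\<^sup>2" for y
      using sum_squares_bound[of "cmod (a y u)" "cmod (a y v)"]
        mult_nonneg_nonneg[OF norm_ge_zero[of "a y u"] norm_ge_zero[of "a y v"]] by linarith
    then have "(\<integral>\<^sup>+y. ennreal (cmod (a y u) * cmod (a y v)) \<partial>lborel) \<le>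
        (\<integral>\<^sup>+y. ennreal ((cmod (a y u))\<^sup>2) + ennreal ((cmod (a y v))\<^sup>2) \<partial>lborel)"
      by (intro nn_integral_mono) (simp flip: ennreal_plus)
    also have "\<dots> = (\<integral>\<^sup>+y. ennreal ((cmod (a y u))\<^sup>2) \<partial>lborel) + (\<integral>\<^sup>+y. ennreal ((cmod (a y v))\<^sup>2) \<partial>lborel)"
      by (intro nn_integral_add) measurable
    also have "\<dots> \<le> ennreal C + ennreal C"
      by (intro add_mono square)
    finally show ?thesis .
  qed
  have FF: "integrable P (\<lambda>p. F (fst p) * cnj (F (snd p)))"
    unfolding P_def by (rule integrable_lborel_pair) (use F in auto)
  have "(\<integral>\<^sup>+q. ennreal (norm (Q q)) \<partial>(lborel \<Otimes>\<^sub>M P)) = (\<integral>\<^sup>+p. \<integral>\<^sup>+y. ennreal (norm (Q (y, p))) \<partial>lborel \<partial>P)"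
    by (subst P.nn_integral_snd[symmetric]) simp_all
  also have "\<dots> = (\<integral>\<^sup>+p. ennreal (cmod (F (fst p) * cnj (F (snd p)))) *
      (\<integral>\<^sup>+y. ennreal (cmod (a y (fst p)) * cmod (a y (snd p))) \<partial>lborel) \<partial>P)"
    by (subst nn_integral_cmult[symmetric])
       (auto simp: Q_def norm_mult ennreal_mult[symmetric] ac_simps intro!: nn_integral_cong)
  also have "\<dots> \<le> (\<integral>\<^sup>+p. ennreal (cmod (F (fst p) * cnj (F (snd p)))) * (ennreal C + ennreal C) \<partial>P)"
    by (intro nn_integral_mono mult_left_mono C) auto
  also have "\<dots> = (\<integral>\<^sup>+p. ennreal (cmod (F (fst p) * cnj (F (snd p)))) \<partial>P) * (ennreal C + ennreal C)"
    by (rule nn_integral_multc) (use FF in auto)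
  also have "\<dots> < \<infinity>"
    using FF unfolding integrable_iff_bounded by (auto simp: ennreal_mult_less_top)
  finally have Q: "integrable (lborel \<Otimes>\<^sub>M P) Q"
    by (intro integrableI_bounded) auto
  have inner: "(\<integral>p. Q (y, p) \<partial>P) = complex_of_real ((cmod (\<integral>u. F u * a y u \<partial>lborel))\<^sup>2)" for y
  proof -
    have Fa: "integrable lborel (\<lambda>u. F u * a y u)"
      by (rule Bochner_Integration.integrable_bound[OF F])
         (auto simp: norm_mult intro!: AE_I2 mult_left_le bound)
    show ?thesis
      unfolding Q_def P_def prod.case
      by (subst integral_lborel_pair[OF Fa])
         (simp_all only: integrable_cnj[OF Fa] Bochner_Integration.integral_cnj complex_norm_square)
  qed
  have "integrable lborel (\<lambda>y. complex_of_real ((cmod (\<integral>u. F u * a y u \<partial>lborel))\<^sup>2))"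
    using P.integrable_fst'[OF Q] by (simp add: inner)
  then show "integrable lborel (\<lambda>y. (cmod (\<integral>u. F u * a y u \<partial>lborel))\<^sup>2)"
    by (simp only: complex_of_real_integrable_eq)
  have "complex_of_real (\<integral>y. (cmod (\<integral>u. F u * a y u \<partial>lborel))\<^sup>2 \<partial>lborel) = (\<integral>y. \<integral>p. Q (y, p) \<partial>P \<partial>lborel)"
    by (simp only: inner integral_complex_of_real)
  also have "\<dots> = (\<integral>p. \<integral>y. Q (y, p) \<partial>lborel \<partial>P)"
    using P.Fubini_integral[of "\<lambda>y p. Q (y, p)"] Q by simp
  also have "\<dots> = (\<integral>p. F (fst p) * cnj (F (snd p)) * (\<integral>y. a y (fst p) * cnj (a y (snd p)) \<partial>lborel) \<partial>P)"
    by (intro Bochner_Integration.integral_cong refl, subst integral_mult_right_zero[symmetric])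
       (auto simp: Q_def ac_simps)
  finally show "complex_of_real (\<integral>y. (cmod (\<integral>u. F u * a y u \<partial>lborel))\<^sup>2 \<partial>lborel) =
      (\<integral>p. F (fst p) * cnj (F (snd p)) * (\<integral>y. a y (fst p) * cnj (a y (snd p)) \<partial>lborel)
         \<partial>(lborel \<Otimes>\<^sub>M lborel))"
    by (simp add: P_def)
qed

section \<open>Continuity of translations in L^1\<close>

lemma
  fixes f :: "'a::euclidean_space \<Rightarrow> 'b::{banach, second_countable_topology}"
  assumes [measurable]: "f \<in> borel_measurable borel"
  shows integrable_lborel_translate: "integrable lborel (\<lambda>x. f (x + z)) \<longleftrightarrow> integrable lborel f"
    and integral_lborel_translate: "(\<integral>x. f (x + z) \<partial>lborel) = (\<integral>x. f x \<partial>lborel)"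
  by (subst (2) lborel_distr_plus[symmetric, of z],
      (subst integrable_distr_eq | subst integral_distr), auto simp: add.commute)+

lemma nn_integral_lborel_translate:
  fixes f :: "'a::euclidean_space \<Rightarrow> ennreal"
  assumes [measurable]: "f \<in> borel_measurable borel"
  shows "(\<integral>\<^sup>+x. f (x + z) \<partial>lborel) = (\<integral>\<^sup>+x. f x \<partial>lborel)"
  by (subst (2) lborel_distr_plus[symmetric, of z], subst nn_integral_distr) (auto simp: add.commute)

text \<open>The functions whose translates along \<open>z\<close> converge back in L^1 form an
  L^1-closed set: by translation invariance the error of replacing \<open>F\<close> by
  \<open>G\<close> is the same before and after a shift. It is paid twice, which explains
  \<open>e / 4\<close>.\<close>

lemma L1_translation_closure:
  fixes F :: "'a::euclidean_space \<Rightarrow> 'b::{banach, second_countable_topology}"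
  assumes F: "integrable lborel F"
    and approx: "\<And>e. e > 0 \<Longrightarrow> \<exists>G. integrable lborel G \<and> (\<integral>x. norm (F x - G x) \<partial>lborel) \<le> e \<and>
      (\<lambda>n. \<integral>x. norm (G (x + z n) - G x) \<partial>lborel) \<longlonglongrightarrow> 0"
  shows "(\<lambda>n. \<integral>x. norm (F (x + z n) - F x) \<partial>lborel) \<longlonglongrightarrow> 0"
proof (rule LIMSEQ_I)
  fix e :: real
  assume e: "e > 0"
  then obtain G where G: "integrable lborel G" "(\<integral>x. norm (F x - G x) \<partial>lborel) \<le> e / 4"
      "(\<lambda>n. \<integral>x. norm (G (x + z n) - G x) \<partial>lborel) \<longlonglongrightarrow> 0"
    using approx[of "e / 4"] by auto
  have meas [measurable]: "F \<in> borel_measurable borel" "G \<in> borel_measurable borel"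
    using F G by auto
  note int = integrable_lborel_translate[THEN iffD2, OF meas(1) F]
    integrable_lborel_translate[THEN iffD2, OF meas(2) G(1)] F G(1)
  have *: "(\<integral>x. norm (F (x + y) - F x) \<partial>lborel) \<le> (\<integral>x. norm (G (x + y) - G x) \<partial>lborel) + e / 2" for y
  proof -
    have "(\<integral>x. norm (F (x + y) - F x) \<partial>lborel) \<le>
        (\<integral>x. norm (G (x + y) - G x) + (norm (F (x + y) - G (x + y)) + norm (F x - G x)) \<partial>lborel)"
    proof (intro integral_mono)
      show "norm (F (x + y) - F x) \<le>
          norm (G (x + y) - G x) + (norm (F (x + y) - G (x + y)) + norm (F x - G x))" for x
        using norm_triangle_ineq[of "G (x + y) - G x" "(F (x + y) - G (x + y)) - (F x - G x)"]
          norm_triangle_ineq4[of "F (x + y) - G (x + y)" "F x - G x"]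
        by (simp add: algebra_simps)
    qed (use int in auto)
    also have "\<dots> = (\<integral>x. norm (G (x + y) - G x) \<partial>lborel) +
        ((\<integral>x. norm (F (x + y) - G (x + y)) \<partial>lborel) + (\<integral>x. norm (F x - G x) \<partial>lborel))"
      using int by simp
    also have "(\<integral>x. norm (F (x + y) - G (x + y)) \<partial>lborel) = (\<integral>x. norm (F x - G x) \<partial>lborel)"
      by (subst integral_lborel_translate[of "\<lambda>x. norm (F x - G x)"]) auto
    finally show ?thesis
      using G(2) by simp
  qed
  obtain N where N: "\<And>n. n \<ge> N \<Longrightarrow> (\<integral>x. norm (G (x + z n) - G x) \<partial>lborel) < e / 2"
    using LIMSEQ_D[OF G(3), of "e / 2"] e by auto
  show "\<exists>N. \<forall>n\<ge>N. norm ((\<integral>x. norm (F (x + z n) - F x) \<partial>lborel) - 0) < e"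
  proof (intro exI[of _ N] allI impI)
    fix n assume "n \<ge> N"
    then show "norm ((\<integral>x. norm (F (x + z n) - F x) \<partial>lborel) - 0) < e"
      using N[of n] *[of "z n"] by simp
  qed
qed

text \<open>The difference of the indicators need not tend to 0 on the boundary of \<open>U\<close>,
  which may have positive measure. But \<open>U\<close> and its translate have equal measure, so the
  two one-sided differences have equal integrals, and only the one supported in \<open>U\<close> has
  to be estimated; there openness gives pointwise convergence.\<close>

lemma L1_translation_open:
  fixes U :: "'a::euclidean_space set"
  assumes U: "open U" and fin: "emeasure lborel U < \<infinity>" and z: "z \<longlonglongrightarrow> 0"
  shows "(\<lambda>n. \<integral>x. norm (indicator U (x + z n) - indicator U x :: real) \<partial>lborel) \<longlonglongrightarrow> 0"
proof -
  have [measurable]: "U \<in> sets borel"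
    using U by auto
  have int: "integrable lborel (indicator U :: 'a \<Rightarrow> real)"
    using fin by auto
  have int': "integrable lborel (\<lambda>x. indicator U (x + y) :: real)" for y
    using integrable_lborel_translate[of "indicator U :: 'a \<Rightarrow> real" y] int by auto
  have int2: "integrable lborel (\<lambda>x. indicator U x * (1 - indicator U (x + y)) :: real)" for y
    by (rule Bochner_Integration.integrable_bound[OF int]) (auto split: split_indicator)
  have eq: "(\<integral>x. norm (indicator U (x + y) - indicator U x :: real) \<partial>lborel) =
      2 * (\<integral>x. indicator U x * (1 - indicator U (x + y)) \<partial>lborel)" for y
  proof -
    have "(\<integral>x. norm (indicator U (x + y) - indicator U x :: real) \<partial>lborel) =
        (\<integral>x. (indicator U (x + y) - indicator U x) + 2 * (indicator U x * (1 - indicator U (x + y))) \<partial>lborel)"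
      by (intro Bochner_Integration.integral_cong refl) (auto split: split_indicator)
    also have "\<dots> = (\<integral>x. indicator U (x + y) \<partial>lborel) - (\<integral>x. indicator U x \<partial>lborel) +
        2 * (\<integral>x. indicator U x * (1 - indicator U (x + y)) \<partial>lborel)"
      using int int'[of y] int2[of y]
      by (simp add: Bochner_Integration.integral_add Bochner_Integration.integral_diff)
    finally show ?thesis
      using integral_lborel_translate[of "indicator U :: 'a \<Rightarrow> real" y] by simp
  qed
  have "(\<lambda>n. \<integral>x. indicator U x * (1 - indicator U (x + z n)) \<partial>lborel) \<longlonglongrightarrow> (\<integral>x. (0::real) \<partial>(lborel :: 'a measure))"
  proof (rule integral_dominated_convergence[where w = "indicator U"])
    show "AE x in lborel. (\<lambda>n. indicator U x * (1 - indicator U (x + z n)) :: real) \<longlonglongrightarrow> 0"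
    proof (rule AE_I2)
      fix x :: 'a
      show "(\<lambda>n. indicator U x * (1 - indicator U (x + z n)) :: real) \<longlonglongrightarrow> 0"
      proof (cases "x \<in> U")
        case True
        have "(\<lambda>n. x + z n) \<longlonglongrightarrow> x"
          using tendsto_add[OF tendsto_const[of x] z] by simp
        then have "eventually (\<lambda>n. x + z n \<in> U) sequentially"
          using U True by (simp add: topological_tendstoD)
        then show ?thesis
          by (intro tendsto_eventually, elim eventually_mono) auto
      qed simp
    qed
  qed (use int in \<open>auto split: split_indicator\<close>)
  then have "(\<lambda>n. 2 * (\<integral>x. indicator U x * (1 - indicator U (x + z n)) \<partial>lborel)) \<longlonglongrightarrow> 2 * (0::real)"
    by (intro tendsto_mult_left) simp
  then show ?thesis
    unfolding eq by simp
qed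

text \<open>Outer regularity approximates a Borel set of finite measure by an open one.
  \<open>L1_translation_closure\<close> then carries the claim from open to Borel sets, and again
  from simple functions to their limits.\<close>

lemma L1_translation_continuous:
  fixes F :: "'a::euclidean_space \<Rightarrow> 'b::{banach, second_countable_topology}"
  assumes F: "integrable lborel F" and z: "z \<longlonglongrightarrow> 0"
  shows "(\<lambda>n. \<integral>x. norm (F (x + z n) - F x) \<partial>lborel) \<longlonglongrightarrow> 0"
  using F
proof (induction F rule: integrable_induct)
  case (base A c)
  show ?case
  proof (rule L1_translation_closure)
    show "integrable lborel (\<lambda>x. indicator A x *\<^sub>R c)"
      using base by auto
    fix e :: real assume e: "e > 0"
    have A [measurable]: "A \<in> sets borel"
      using base by simp
    \<comment> \<open>The summand 1 keeps the denominator positive when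
      \<open>c = 0\<close>.\<close>
    define d where "d = e / (norm c + 1)"
    have d: "d > 0" "norm c * d \<le> e"
      using e by (auto simp: d_def field_simps add_pos_nonneg)
    obtain U where U: "open U" "A \<subseteq> U" "emeasure lborel (U - A) < ennreal d"
      using outer_regular_lborel[OF A d(1)] by metis
    have [measurable]: "U \<in> sets borel"
      using U by auto
    have UA: "U = A \<union> (U - A)"
      using U by auto
    have "emeasure lborel U \<le> emeasure lborel A + emeasure lborel (U - A)"
      using UA emeasure_subadditive[of A lborel "U - A"] by auto
    also have "\<dots> < \<infinity>"
      using base U(3) by (auto simp: less_top[symmetric])
    finally have fin: "emeasure lborel U < \<infinity>" .
    have "(\<integral>x. norm (indicator A x *\<^sub>R c - indicator U x *\<^sub>R c) \<partial>lborel) =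
        (\<integral>x. norm c * indicator (U - A) x \<partial>lborel)"
      using U(2) by (intro Bochner_Integration.integral_cong refl) (auto split: split_indicator)
    also have "\<dots> = norm c * measure lborel (U - A)"
      by simp
    also have "\<dots> \<le> norm c * d"
      using U(3) d(1) by (intro mult_left_mono) (auto simp: measure_def enn2real_leI)
    finally have 1: "(\<integral>x. norm (indicator A x *\<^sub>R c - indicator U x *\<^sub>R c) \<partial>lborel) \<le> e"
      using d(2) by simp
    have "(\<lambda>n. norm c * (\<integral>x. norm (indicator U (x + z n) - indicator U x :: real) \<partial>lborel)) \<longlonglongrightarrow> norm c * 0"
      by (intro tendsto_mult_left L1_translation_open U fin z)
    then have 2: "(\<lambda>n. \<integral>x. norm (indicator U (x + z n) *\<^sub>R c - indicator U x *\<^sub>R c) \<partial>lborel) \<longlonglongrightarrow> 0"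
      by (simp flip: scaleR_diff_left add: mult.commute)
    show "\<exists>G. integrable lborel G \<and> (\<integral>x. norm (indicator A x *\<^sub>R c - G x) \<partial>lborel) \<le> e \<and>
      (\<lambda>n. \<integral>x. norm (G (x + z n) - G x) \<partial>lborel) \<longlonglongrightarrow> 0"
      by (rule exI[of _ "\<lambda>x. indicator U x *\<^sub>R c"]) (use 1 2 fin in auto)
  qed
next
  case (add f g)
  have [measurable]: "f \<in> borel_measurable borel" "g \<in> borel_measurable borel"
    using add by auto
  have int: "integrable lborel (\<lambda>x. f (x + y))" "integrable lborel (\<lambda>x. g (x + y))" for y
    by (rule integrable_lborel_translate[THEN iffD2], simp, rule add)+
  have le: "(\<integral>x. norm (f (x + y) + g (x + y) - (f x + g x)) \<partial>lborel) \<le>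
      (\<integral>x. norm (f (x + y) - f x) \<partial>lborel) + (\<integral>x. norm (g (x + y) - g x) \<partial>lborel)" for y
  proof -
    have "(\<integral>x. norm (f (x + y) + g (x + y) - (f x + g x)) \<partial>lborel) \<le>
      (\<integral>x. norm (f (x + y) - f x) + norm (g (x + y) - g x) \<partial>lborel)"
    proof (intro integral_mono)
      show "norm (f (x + y) + g (x + y) - (f x + g x)) \<le> norm (f (x + y) - f x) + norm (g (x + y) - g x)" for x
        using norm_triangle_ineq[of "f (x + y) - f x" "g (x + y) - g x"] by (simp add: algebra_simps)
    qed (use add int in auto)
    then show ?thesis
      using add int by simp
  qed
  have upper: "(\<lambda>n. (\<integral>x. norm (f (x + z n) - f x) \<partial>lborel) +
      (\<integral>x. norm (g (x + z n) - g x) \<partial>lborel)) \<longlonglongrightarrow> 0"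
    using tendsto_add[OF add(3,4)] by simp
  show ?case
    by (rule tendsto_sandwich[OF _ _ tendsto_const upper]; intro always_eventually allI)
       (rule Bochner_Integration.integral_nonneg norm_ge_zero le)+
next
  case (lim f s)
  have [measurable]: "\<And>i. s i \<in> borel_measurable borel" "f \<in> borel_measurable borel"
    using lim by auto
  \<comment> \<open>The induction rule supplies \<open>norm (s i x) \<le> 2 * norm (f x)\<close>,
    whence the dominating function \<open>3 * norm (f x)\<close>.\<close>
  have conv: "(\<lambda>i. \<integral>x. norm (f x - s i x) \<partial>lborel) \<longlonglongrightarrow> (\<integral>x. norm (0::'b) \<partial>(lborel :: 'a measure))"
  proof (rule integral_dominated_convergence[where w = "\<lambda>x. 3 * norm (f x)"])
    show "AE x in lborel. (\<lambda>i. norm (f x - s i x)) \<longlonglongrightarrow> norm (0::'b)"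
    proof (intro AE_I2 tendsto_norm)
      show "(\<lambda>i. f x - s i x) \<longlonglongrightarrow> 0" for x
        using tendsto_diff[OF tendsto_const[of "f x"] lim(2)[of x]] by simp
    qed
    show "AE x in lborel. norm (norm (f x - s i x)) \<le> 3 * norm (f x)" for i
    proof (intro AE_I2)
      show "norm (norm (f x - s i x)) \<le> 3 * norm (f x)" for x
        using norm_triangle_ineq4[of "f x" "s i x"] lim(3)[of x i] by simp
    qed
  qed (use lim in auto)
  show ?case
  proof (rule L1_translation_closure[OF lim(4)])
    fix e :: real assume "e > 0"
    then obtain i where "(\<integral>x. norm (f x - s i x) \<partial>lborel) < e"
      using LIMSEQ_D[OF conv, of e] by auto
    then show "\<exists>G. integrable lborel G \<and> (\<integral>x. norm (f x - G x) \<partial>lborel) \<le> e \<and>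
      (\<lambda>n. \<integral>x. norm (G (x + z n) - G x) \<partial>lborel) \<longlonglongrightarrow> 0"
      using lim by (intro exI[of _ "s i"]) auto
  qed
qed

section \<open>Gaussian averages and their limits\<close>

text \<open>The parallelogram law seen from the midpoint. It splits a product of Gaussians centred
  at \<open>u\<close> and \<open>v\<close> into a factor in \<open>u - v\<close> and a Gaussian in
  \<open>x\<close> centred at the midpoint.\<close>

lemma norm_midpoint_identity:
  fixes u v x :: "'a::real_inner"
  shows "(norm (u - x))\<^sup>2 + (norm (v - x))\<^sup>2 =
    2 * (norm (x - (1 / 2) *\<^sub>R (u + v)))\<^sup>2 + (norm (u - v))\<^sup>2 / 2"
  unfolding power2_norm_eq_inner
  by (simp add: inner_add_left inner_add_right inner_diff_left inner_diff_right inner_commute field_simps)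

text \<open>The convolution of \<open>F\<close> with a Gaussian of width \<open>r\<close>; for
  positive \<open>r\<close> the denominator normalises the kernel to mass 1.\<close>

definition gauss_conv :: "('a::euclidean_space \<Rightarrow> complex) \<Rightarrow> real \<Rightarrow> 'a \<Rightarrow> complex" where
  "gauss_conv F r x = (\<integral>u. F u * complex_of_real (exp (- (norm (u - x) / r)\<^sup>2)) \<partial>lborel) /
     complex_of_real ((sqrt pi * r) ^ DIM('a))"

lemma has_integral_gauss_kernel:
  assumes r: "r > 0"
  shows "has_bochner_integral lborel (\<lambda>x::'a::euclidean_space. exp (- (norm x / r)\<^sup>2)) ((sqrt pi * r) ^ DIM('a))"
proof -
  have "sqrt (2 * pi) / (sqrt 2 / r) = sqrt pi * r"
    using r by (simp add: real_sqrt_mult)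
  moreover have "- (sqrt 2 / r * norm x)\<^sup>2 / 2 = - (norm x / r)\<^sup>2" for x :: 'a
    by (simp add: power_mult_distrib power_divide)
  ultimately show ?thesis
    using gaussian_integral[of "sqrt 2 / r", where 'a = 'a] r by simp
qed

text \<open>
  Both sides are squared norms of kernel operators applied to \<open>F\<close>, with kernels
  \<open>e\<^bsup>i y u\<^esup> e\<^bsup>-r\<^sup>2 |y|\<^sup>2 / 4\<^esup>\<close> and \<open>e\<^bsup>-|u - x|\<^sup>2 / r\<^sup>2\<^esup>\<close>; integrating out \<open>y\<close> respectively \<open>x\<close> turns them into
  the same Gaussian quadratic form in \<open>F\<close>.
\<close>

lemma
  fixes F :: "'a::euclidean_space \<Rightarrow> complex"
  assumes F: "integrable lborel F" and r: "r > 0"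
  shows integrable_fourier_gauss: "integrable lborel
      (\<lambda>y. (cmod (\<integral>u. F u * exp (\<i> * complex_of_real (y \<bullet> u)) \<partial>lborel))\<^sup>2 * exp (- (r * norm y)\<^sup>2 / 2))"
    and integrable_gauss_conv_square: "integrable lborel (\<lambda>x. (cmod (gauss_conv F r x))\<^sup>2)"
    and integral_fourier_gauss:
      "(\<integral>y. (cmod (\<integral>u. F u * exp (\<i> * complex_of_real (y \<bullet> u)) \<partial>lborel))\<^sup>2 * exp (- (r * norm y)\<^sup>2 / 2) \<partial>lborel) =
       (2 * pi) ^ DIM('a) * (\<integral>x. (cmod (gauss_conv F r x))\<^sup>2 \<partial>lborel)"
proof -
  \<comment> \<open>Each kernel carries half of the exponent: in
    \<open>a1 y u * cnj (a1 y v)\<close> the two factors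
    \<open>exp (- (r * norm y)\<^sup>2 / 4)\<close> multiply to the weight of the statement.\<close>
  define a1 :: "'a \<Rightarrow> 'a \<Rightarrow> complex" where
    "a1 y u = exp (\<i> * complex_of_real (y \<bullet> u)) * complex_of_real (exp (- (r * norm y)\<^sup>2 / 4))" for y u
  define a2 :: "'a \<Rightarrow> 'a \<Rightarrow> complex" where
    "a2 x u = complex_of_real (exp (- (norm (u - x) / r)\<^sup>2))" for x u
  define n where "n = (sqrt pi * r) ^ DIM('a)"
  have n: "n > 0"
    using r by (simp add: n_def)
  have K1: "(\<integral>y. a1 y u * cnj (a1 y v) \<partial>lborel) =
      complex_of_real ((sqrt (2 * pi) / r) ^ DIM('a) * exp (- (norm (u - v) / r)\<^sup>2 / 2))" for u v
  proof -
    have "a1 y u * cnj (a1 y v) =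
        exp (\<i> * complex_of_real (y \<bullet> (u - v))) * complex_of_real (exp (- (r * norm y)\<^sup>2 / 2))" for y
      unfolding a1_def
      by (simp add: exp_cnj inner_diff_right exp_diff exp_minus right_diff_distrib field_simps
          flip: exp_add of_real_mult)
    then show ?thesis
      using gaussian_fourier[OF r, of "u - v"] by (simp only: has_bochner_integral_iff)
  qed
  \<comment> \<open>By the midpoint identity the dependence on \<open>x\<close> is a Gaussian
    centred at \<open>(u + v) / 2\<close> with parameter \<open>2 / r\<close>, and its integral does
    not depend on the centre.\<close>
  have K2: "(\<integral>x. a2 x u * cnj (a2 x v) \<partial>lborel) =
      complex_of_real ((sqrt (2 * pi) * r / 2) ^ DIM('a) * exp (- (norm (u - v) / r)\<^sup>2 / 2))" for u v
  proof -
    let ?g = "\<lambda>x::'a. exp (- (2 / r * norm x)\<^sup>2 / 2)"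
    have "- (norm (u - x) / r)\<^sup>2 + - (norm (v - x) / r)\<^sup>2 =
        - (norm (u - v) / r)\<^sup>2 / 2 + - (2 / r * norm (x + - (1 / 2) *\<^sub>R (u + v)))\<^sup>2 / 2" for x
    proof -
      have "- (norm (u - x) / r)\<^sup>2 + - (norm (v - x) / r)\<^sup>2 = - (((norm (u - x))\<^sup>2 + (norm (v - x))\<^sup>2) / r\<^sup>2)"
        by (simp add: power_divide add_divide_distrib)
      also have "\<dots> = - ((norm (u - v))\<^sup>2 / r\<^sup>2) / 2 + - (4 / r\<^sup>2 * (norm (x - (1 / 2) *\<^sub>R (u + v)))\<^sup>2) / 2"
        unfolding norm_midpoint_identity using r by (simp add: field_simps)
      finally show ?thesis
        by (simp add: power_divide power_mult_distrib)
    qed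
    then have "a2 x u * cnj (a2 x v) =
        complex_of_real (exp (- (norm (u - v) / r)\<^sup>2 / 2) * ?g (x + - (1 / 2) *\<^sub>R (u + v)))" for x
      unfolding a2_def by (simp only: exp_add[symmetric] of_real_mult[symmetric] complex_cnj_complex_of_real)
    moreover have "(\<integral>x. ?g (x + - (1 / 2) *\<^sub>R (u + v)) \<partial>lborel) = (\<integral>x. ?g x \<partial>lborel)"
      by (rule integral_lborel_translate) measurable
    moreover have "(\<integral>x. ?g x \<partial>lborel) = (sqrt (2 * pi) * r / 2) ^ DIM('a)"
      using gaussian_integral[of "2 / r", where 'a = 'a] r by (simp add: has_bochner_integral_iff)
    ultimately show ?thesis
      by (simp only: integral_complex_of_real integral_mult_right_zero mult.commute)
  qed
  \<comment> \<open>Per coordinate the ratio of the two constants is \<open>2 / r^2\<close>, that is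
    \<open>2 * pi / (sqrt pi * r)^2\<close>; the denominators collect into the square of the kernel
    mass \<open>n\<close>. This is the origin of the constant in Plancherel's theorem.\<close>
  have K: "(\<integral>y. a1 y u * cnj (a1 y v) \<partial>lborel) =
      complex_of_real ((2 * pi) ^ DIM('a) / n\<^sup>2) * (\<integral>x. a2 x u * cnj (a2 x v) \<partial>lborel)" for u v
  proof -
    have "(sqrt (2 * pi) / r) = (2 * pi) / (sqrt pi * r)\<^sup>2 * (sqrt (2 * pi) * r / 2)"
      using r by (simp add: field_simps power2_eq_square)
    then have "(sqrt (2 * pi) / r) ^ DIM('a) =
        (2 * pi) ^ DIM('a) / n\<^sup>2 * (sqrt (2 * pi) * r / 2) ^ DIM('a)"
      by (simp only: n_def power_mult_distrib power_divide power_mult[symmetric] mult.commute)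
    then show ?thesis
      unfolding K1 K2 by (simp only: of_real_mult mult.assoc)
  qed
  have m1: "(\<lambda>p. a1 (fst p) (snd p)) \<in> borel_measurable borel"
    unfolding a1_def by (intro borel_measurable_continuous_onI continuous_intros) auto
  have m2: "(\<lambda>p. a2 (fst p) (snd p)) \<in> borel_measurable borel"
    unfolding a2_def by (intro borel_measurable_continuous_onI continuous_intros) (use r in auto)
  have norm1: "(cmod (a1 y u))\<^sup>2 = exp (- (r * norm y)\<^sup>2 / 2)" for y u
    by (simp add: a1_def norm_mult power_mult_distrib flip: exp_double)
  have norm2: "(cmod (a2 x u))\<^sup>2 = exp (- (sqrt 2 / r * sqrt 2 * norm (x + - u))\<^sup>2 / 2)" for x u
    by (simp add: a2_def norm_minus_commute power_mult_distrib power_divide flip: exp_double)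
  have bd1: "cmod (a1 y u) \<le> 1" for y u
    by (simp add: a1_def norm_mult)
  have bd2: "cmod (a2 y u) \<le> 1" for y u
    by (simp add: a2_def)
  have nn: "(\<integral>\<^sup>+y. ennreal (exp (- (s * norm (y + c))\<^sup>2 / 2)) \<partial>lborel) = ennreal ((sqrt (2 * pi) / s) ^ DIM('a))"
    if "s > 0" for s and c :: 'a
  proof -
    have "(\<integral>\<^sup>+y. ennreal (exp (- (s * norm (y + c))\<^sup>2 / 2)) \<partial>lborel) =
        (\<integral>\<^sup>+y. ennreal (exp (- (s * norm y)\<^sup>2 / 2)) \<partial>(lborel :: 'a measure))"
      by (rule nn_integral_lborel_translate) measurable
    also have "\<dots> = ennreal ((sqrt (2 * pi) / s) ^ DIM('a))"
      using gaussian_integral[OF that, where 'a = 'a]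
      by (subst nn_integral_eq_integral) (auto simp: has_bochner_integral_iff)
    finally show ?thesis .
  qed
  have sq1: "(\<integral>\<^sup>+y. ennreal ((cmod (a1 y u))\<^sup>2) \<partial>lborel) \<le> ennreal ((sqrt (2 * pi) / r) ^ DIM('a))" for u
    unfolding norm1 using nn[OF r, of 0] by simp
  have sq2: "(\<integral>\<^sup>+x. ennreal ((cmod (a2 x u))\<^sup>2) \<partial>lborel) \<le>
      ennreal ((sqrt (2 * pi) / (sqrt 2 / r * sqrt 2)) ^ DIM('a))" for u
    unfolding norm2 by (subst nn) (use r in auto)
  note k1 = F m1 bd1 sq1 and k2 = F m2 bd2 sq2
  have A1: "(cmod (\<integral>u. F u * a1 y u \<partial>lborel))\<^sup>2 =
      (cmod (\<integral>u. F u * exp (\<i> * complex_of_real (y \<bullet> u)) \<partial>lborel))\<^sup>2 * exp (- (r * norm y)\<^sup>2 / 2)" for y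
  proof -
    have "(\<integral>u. F u * a1 y u \<partial>lborel) =
        (\<integral>u. F u * exp (\<i> * complex_of_real (y \<bullet> u)) \<partial>lborel) * complex_of_real (exp (- (r * norm y)\<^sup>2 / 4))"
      unfolding a1_def mult.assoc[symmetric] by (rule integral_mult_left_zero)
    then show ?thesis
      by (simp add: norm_mult power_mult_distrib flip: exp_double)
  qed
  have A2: "(cmod (\<integral>u. F u * a2 x u \<partial>lborel))\<^sup>2 = n\<^sup>2 * (cmod (gauss_conv F r x))\<^sup>2" for x
    using n r by (simp add: gauss_conv_def a2_def n_def norm_divide norm_power norm_mult power_divide)
  show "integrable lborel
      (\<lambda>y. (cmod (\<integral>u. F u * exp (\<i> * complex_of_real (y \<bullet> u)) \<partial>lborel))\<^sup>2 * exp (- (r * norm y)\<^sup>2 / 2))"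
    using integrable_kernel_square[OF k1] by (simp only: A1)
  show "integrable lborel (\<lambda>x. (cmod (gauss_conv F r x))\<^sup>2)"
    using integrable_kernel_square[OF k2] n by (simp add: A2)
  have "complex_of_real (\<integral>y. (cmod (\<integral>u. F u * a1 y u \<partial>lborel))\<^sup>2 \<partial>lborel) =
      complex_of_real ((2 * pi) ^ DIM('a) / n\<^sup>2) * complex_of_real (\<integral>y. (cmod (\<integral>u. F u * a2 y u \<partial>lborel))\<^sup>2 \<partial>lborel)"
    unfolding integral_kernel_square[OF k1] integral_kernel_square[OF k2] K
    by (subst integral_mult_right_zero[symmetric]) (simp only: ac_simps)
  then have "(\<integral>y. (cmod (\<integral>u. F u * a1 y u \<partial>lborel))\<^sup>2 \<partial>lborel) =
      (2 * pi) ^ DIM('a) / n\<^sup>2 * (\<integral>y. (cmod (\<integral>u. F u * a2 y u \<partial>lborel))\<^sup>2 \<partial>lborel)"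
    by (simp only: of_real_mult[symmetric] of_real_eq_iff)
  then show "(\<integral>y. (cmod (\<integral>u. F u * exp (\<i> * complex_of_real (y \<bullet> u)) \<partial>lborel))\<^sup>2 * exp (- (r * norm y)\<^sup>2 / 2) \<partial>lborel) =
       (2 * pi) ^ DIM('a) * (\<integral>x. (cmod (gauss_conv F r x))\<^sup>2 \<partial>lborel)"
    unfolding A1 A2 using n by simp
qed

lemma gauss_conv_measurable [measurable]:
  assumes [measurable]: "F \<in> borel_measurable borel"
  shows "gauss_conv F r \<in> borel_measurable borel"
  unfolding gauss_conv_def[abs_def] by measurable

lemma nn_integral_gauss_kernel:
  fixes x :: "'a::euclidean_space"
  assumes r: "r > 0"
  shows "(\<integral>\<^sup>+u. ennreal (exp (- (norm (u - x) / r)\<^sup>2)) \<partial>lborel) = ennreal ((sqrt pi * r) ^ DIM('a))"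
proof -
  have "(\<integral>\<^sup>+u. ennreal (exp (- (norm (u + - x) / r)\<^sup>2)) \<partial>lborel) =
      (\<integral>\<^sup>+u. ennreal (exp (- (norm u / r)\<^sup>2)) \<partial>(lborel :: 'a measure))"
    by (rule nn_integral_lborel_translate) measurable
  also have "\<dots> = ennreal ((sqrt pi * r) ^ DIM('a))"
    using has_integral_gauss_kernel[OF r, where 'a = 'a]
    by (subst nn_integral_eq_integral) (auto simp: has_bochner_integral_iff)
  finally show ?thesis
    by simp
qed

text \<open>Averaging against a probability density contracts L^2. Cauchy-Schwarz is applied with
  \<open>k\<close> split into \<open>sqrt k * sqrt k\<close>, one root staying with
  \<open>F\<close>; the mass of the kernel is then used once in \<open>u\<close> and, after Tonelli,
  once in \<open>x\<close>.\<close>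

lemma nn_integral_gauss_conv_square_le:
  fixes F :: "'a::euclidean_space \<Rightarrow> complex"
  assumes F: "integrable lborel F" and r: "r > 0"
  shows "(\<integral>\<^sup>+x. ennreal ((cmod (gauss_conv F r x))\<^sup>2) \<partial>lborel) \<le> (\<integral>\<^sup>+u. ennreal ((cmod (F u))\<^sup>2) \<partial>lborel)"
proof -
  have [measurable]: "F \<in> borel_measurable borel"
    using F by auto
  define n where "n = (sqrt pi * r) ^ DIM('a)"
  have n: "n > 0"
    using r by (simp add: n_def)
  define k where "k = (\<lambda>x u::'a. exp (- (norm (u - x) / r)\<^sup>2))"
  have k [measurable]: "(\<lambda>p. k (fst p) (snd p)) \<in> borel_measurable (borel \<Otimes>\<^sub>M borel)" "k x \<in> borel_measurable borel"
      "(\<lambda>x. k x u) \<in> borel_measurable borel" for x u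
    unfolding k_def by measurable
  have ik: "(\<integral>\<^sup>+u. ennreal (k x u) \<partial>lborel) = ennreal n" "(\<integral>\<^sup>+x. ennreal (k x u) \<partial>lborel) = ennreal n" for x u
    using nn_integral_gauss_kernel[OF r, of x] nn_integral_gauss_kernel[OF r, of u]
    by (simp_all add: k_def n_def norm_minus_commute)
  have pos: "k x u > 0" for x u
    by (simp add: k_def)
  have le: "ennreal ((cmod (gauss_conv F r x))\<^sup>2) \<le>
      ennreal (1 / n) * (\<integral>\<^sup>+u. ennreal ((cmod (F u))\<^sup>2) * ennreal (k x u) \<partial>lborel)" for x
  proof -
    have Fk: "integrable lborel (\<lambda>u. F u * complex_of_real (k x u))"
      by (rule Bochner_Integration.integrable_bound[OF F])
         (auto simp: norm_mult k_def intro!: AE_I2 mult_left_le)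
    have "cmod (gauss_conv F r x) = cmod (\<integral>u. F u * complex_of_real (k x u) \<partial>lborel) / n"
      using r by (simp add: gauss_conv_def k_def n_def norm_divide norm_power norm_mult)
    then have "ennreal ((cmod (gauss_conv F r x))\<^sup>2) =
        ennreal (1 / n\<^sup>2) * (ennreal (cmod (\<integral>u. F u * complex_of_real (k x u) \<partial>lborel)))\<^sup>2"
      using n by (simp add: power_divide ennreal_power flip: ennreal_mult)
    also have "\<dots> \<le> ennreal (1 / n\<^sup>2) * (\<integral>\<^sup>+u. ennreal (cmod (F u * complex_of_real (k x u))) \<partial>lborel)\<^sup>2"
      by (intro mult_left_mono power_mono integral_norm_bound_ennreal Fk) auto
    also have "(\<integral>\<^sup>+u. ennreal (cmod (F u * complex_of_real (k x u))) \<partial>lborel) =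
        (\<integral>\<^sup>+u. ennreal (cmod (F u) * sqrt (k x u)) * ennreal (sqrt (k x u)) \<partial>lborel)"
      using pos[of x] by (intro nn_integral_cong) (simp add: norm_mult less_imp_le flip: ennreal_mult)
    also have "\<dots>\<^sup>2 \<le> (\<integral>\<^sup>+u. (ennreal (cmod (F u) * sqrt (k x u)))\<^sup>2 \<partial>lborel) *
        (\<integral>\<^sup>+u. (ennreal (sqrt (k x u)))\<^sup>2 \<partial>lborel)"
      by (rule Cauchy_Schwarz_nn_integral) measurable
    also have "\<dots> = (\<integral>\<^sup>+u. ennreal ((cmod (F u))\<^sup>2) * ennreal (k x u) \<partial>lborel) * ennreal n"
      using pos[of x] by (simp add: ennreal_power power_mult_distrib less_imp_le ik flip: ennreal_mult)
    also have "ennreal (1 / n\<^sup>2) * \<dots> = (ennreal (1 / n\<^sup>2) * ennreal n) *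
        (\<integral>\<^sup>+u. ennreal ((cmod (F u))\<^sup>2) * ennreal (k x u) \<partial>lborel)"
      by (simp only: ac_simps)
    also have "ennreal (1 / n\<^sup>2) * ennreal n = ennreal (1 / n)"
      using n by (simp add: power2_eq_square flip: ennreal_mult)
    finally show ?thesis
      by (simp add: mult_left_mono)
  qed
  have "(\<integral>\<^sup>+x. ennreal ((cmod (gauss_conv F r x))\<^sup>2) \<partial>lborel) \<le>
      (\<integral>\<^sup>+x. ennreal (1 / n) * (\<integral>\<^sup>+u. ennreal ((cmod (F u))\<^sup>2) * ennreal (k x u) \<partial>lborel) \<partial>lborel)"
    by (intro nn_integral_mono le)
  also have "\<dots> = ennreal (1 / n) * (\<integral>\<^sup>+x. \<integral>\<^sup>+u. ennreal ((cmod (F u))\<^sup>2) * ennreal (k x u) \<partial>lborel \<partial>lborel)"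
    unfolding k_def by (rule nn_integral_cmult) measurable
  also have "(\<integral>\<^sup>+x. \<integral>\<^sup>+u. ennreal ((cmod (F u))\<^sup>2) * ennreal (k x u) \<partial>lborel \<partial>lborel) =
      (\<integral>\<^sup>+u. \<integral>\<^sup>+x. ennreal ((cmod (F u))\<^sup>2) * ennreal (k x u) \<partial>lborel \<partial>lborel)"
    unfolding k_def by (rule lborel_pair.Fubini'[symmetric]) measurable
  also have "\<dots> = (\<integral>\<^sup>+u. ennreal ((cmod (F u))\<^sup>2) \<partial>lborel) * ennreal n"
    by (simp add: nn_integral_cmult nn_integral_multc ik)
  also have "ennreal (1 / n) * \<dots> = (\<integral>\<^sup>+u. ennreal ((cmod (F u))\<^sup>2) \<partial>lborel) * (ennreal (1 / n) * ennreal n)"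
    by (simp only: ac_simps)
  also have "ennreal (1 / n) * ennreal n = 1"
    using n by (simp flip: ennreal_mult)
  finally show ?thesis
    by simp
qed

lemma nn_integral_lborel_scale:
  fixes f :: "'a::euclidean_space \<Rightarrow> ennreal"
  assumes [measurable]: "f \<in> borel_measurable borel" and r: "r > 0"
  shows "(\<integral>\<^sup>+x. f x \<partial>lborel) = ennreal (r ^ DIM('a)) * (\<integral>\<^sup>+x. f (r *\<^sub>R x) \<partial>lborel)"
  using r by (subst lborel_affine[of r 0]) (auto simp: nn_integral_density nn_integral_distr nn_integral_cmult)

text \<open>The kernel has mass \<open>n\<close>, so \<open>F x\<close> can be moved under the
  integral. The substitution \<open>u = r z\<close> leaves a Gaussian independent of
  \<open>r\<close> and puts all dependence on \<open>r\<close> into the translation, which prepares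
  dominated convergence.\<close>

lemma gauss_conv_diff_le:
  fixes F :: "'a::euclidean_space \<Rightarrow> complex"
  assumes F: "integrable lborel F" and r: "r > 0"
  shows "(\<integral>\<^sup>+x. ennreal (cmod (gauss_conv F r x - F x)) \<partial>lborel) \<le> ennreal (1 / sqrt pi ^ DIM('a)) *
    (\<integral>\<^sup>+z. ennreal (exp (- (norm z)\<^sup>2)) * (\<integral>\<^sup>+x. ennreal (cmod (F (x + r *\<^sub>R z) - F x)) \<partial>lborel) \<partial>lborel)"
proof -
  have Fm [measurable]: "F \<in> borel_measurable borel"
    using F by auto
  define n where "n = (sqrt pi * r) ^ DIM('a)"
  have n: "n > 0"
    using r by (simp add: n_def)
  define k where "k = (\<lambda>u::'a. exp (- (norm u / r)\<^sup>2))"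
  have [measurable]: "k \<in> borel_measurable borel"
    unfolding k_def by measurable
  have k: "integrable lborel (\<lambda>u. complex_of_real (k u))" "(\<integral>u. complex_of_real (k u) \<partial>lborel) = complex_of_real n"
    using has_integral_gauss_kernel[OF r, where 'a = 'a]
    by (auto simp: k_def n_def has_bochner_integral_iff simp del: of_real_mult of_real_power)
  have le: "ennreal (cmod (gauss_conv F r x - F x)) \<le>
      ennreal (1 / n) * (\<integral>\<^sup>+u. ennreal (k u) * ennreal (cmod (F (x + u) - F x)) \<partial>lborel)" for x
  proof -
    have Fx: "integrable lborel (\<lambda>u. F (u + x))"
      by (rule integrable_lborel_translate[THEN iffD2, OF Fm F])
    have Fk: "integrable lborel (\<lambda>u. F (u + x) * complex_of_real (k u))"
      by (rule Bochner_Integration.integrable_bound[OF Fx])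
         (auto simp: norm_mult k_def intro!: AE_I2 mult_left_le)
    have "(\<integral>u. F (u + x) * complex_of_real (k (u + x - x)) \<partial>lborel) =
        (\<integral>u. F u * complex_of_real (k (u - x)) \<partial>lborel)"
      by (rule integral_lborel_translate) measurable
    then have "gauss_conv F r x = (\<integral>u. F (u + x) * complex_of_real (k u) \<partial>lborel) / complex_of_real n"
      by (simp add: gauss_conv_def k_def n_def)
    then have "gauss_conv F r x - F x =
        ((\<integral>u. F (u + x) * complex_of_real (k u) \<partial>lborel) - F x * complex_of_real n) / complex_of_real n"
      using n by (simp add: diff_divide_distrib)
    also have "\<dots> = (\<integral>u. F (u + x) * complex_of_real (k u) - F x * complex_of_real (k u) \<partial>lborel) / complex_of_real n"
      using Fk k by (subst Bochner_Integration.integral_diff) auto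
    finally have "ennreal (cmod (gauss_conv F r x - F x)) = ennreal (1 / n) *
        ennreal (cmod (\<integral>u. F (u + x) * complex_of_real (k u) - F x * complex_of_real (k u) \<partial>lborel))"
      using n by (simp add: norm_divide flip: ennreal_mult)
    also have "\<dots> \<le> ennreal (1 / n) *
        (\<integral>\<^sup>+u. ennreal (cmod (F (u + x) * complex_of_real (k u) - F x * complex_of_real (k u))) \<partial>lborel)"
      using Fk k by (intro mult_left_mono integral_norm_bound_ennreal) auto
    also have "(\<integral>\<^sup>+u. ennreal (cmod (F (u + x) * complex_of_real (k u) - F x * complex_of_real (k u))) \<partial>lborel) =
        (\<integral>\<^sup>+u. ennreal (k u) * ennreal (cmod (F (x + u) - F x)) \<partial>lborel)"
      by (intro nn_integral_cong)
         (simp add: norm_mult k_def add.commute mult.commute flip: left_diff_distrib ennreal_mult)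
    finally show ?thesis .
  qed
  have "(\<integral>\<^sup>+x. ennreal (cmod (gauss_conv F r x - F x)) \<partial>lborel) \<le>
     (\<integral>\<^sup>+x. ennreal (1 / n) * (\<integral>\<^sup>+u. ennreal (k u) * ennreal (cmod (F (x + u) - F x)) \<partial>lborel) \<partial>lborel)"
    by (intro nn_integral_mono le)
  also have "\<dots> = ennreal (1 / n) *
     (\<integral>\<^sup>+x. \<integral>\<^sup>+u. ennreal (k u) * ennreal (cmod (F (x + u) - F x)) \<partial>lborel \<partial>lborel)"
    by (rule nn_integral_cmult) measurable
  also have "(\<integral>\<^sup>+x. \<integral>\<^sup>+u. ennreal (k u) * ennreal (cmod (F (x + u) - F x)) \<partial>lborel \<partial>lborel) =
     (\<integral>\<^sup>+u. \<integral>\<^sup>+x. ennreal (k u) * ennreal (cmod (F (x + u) - F x)) \<partial>lborel \<partial>lborel)"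
    by (rule lborel_pair.Fubini'[symmetric]) measurable
  also have "\<dots> = (\<integral>\<^sup>+u. ennreal (k u) * (\<integral>\<^sup>+x. ennreal (cmod (F (x + u) - F x)) \<partial>lborel) \<partial>lborel)"
    by (intro nn_integral_cong nn_integral_cmult) measurable
  also have "\<dots> = ennreal (r ^ DIM('a)) *
     (\<integral>\<^sup>+z. ennreal (k (r *\<^sub>R z)) * (\<integral>\<^sup>+x. ennreal (cmod (F (x + r *\<^sub>R z) - F x)) \<partial>lborel) \<partial>lborel)"
    by (rule nn_integral_lborel_scale[OF _ r]) measurable
  also have "(\<lambda>z. k (r *\<^sub>R z)) = (\<lambda>z. exp (- (norm z)\<^sup>2))"
    using r by (simp add: k_def)
  also have "ennreal (1 / n) * (ennreal (r ^ DIM('a)) *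
     (\<integral>\<^sup>+z. ennreal (exp (- (norm z)\<^sup>2)) * (\<integral>\<^sup>+x. ennreal (cmod (F (x + r *\<^sub>R z) - F x)) \<partial>lborel) \<partial>lborel)) =
     (ennreal (1 / n) * ennreal (r ^ DIM('a))) *
     (\<integral>\<^sup>+z. ennreal (exp (- (norm z)\<^sup>2)) * (\<integral>\<^sup>+x. ennreal (cmod (F (x + r *\<^sub>R z) - F x)) \<partial>lborel) \<partial>lborel)"
    by (simp only: mult.assoc)
  also have "ennreal (1 / n) * ennreal (r ^ DIM('a)) = ennreal (1 / sqrt pi ^ DIM('a))"
    using r by (simp add: n_def power_mult_distrib flip: ennreal_mult)
  finally show ?thesis .
qed

text \<open>The L^1 distance \<open>w y\<close> between \<open>F\<close> and its translate is at
  most twice the norm of \<open>F\<close> and tends to 0 with \<open>y\<close>, so dominated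
  convergence applies to its Gaussian average.\<close>

lemma gauss_conv_tendsto_L1:
  fixes F :: "'a::euclidean_space \<Rightarrow> complex"
  assumes F: "integrable lborel F" and r: "\<And>i::nat. r i > 0" "r \<longlonglongrightarrow> 0"
  shows "\<And>i. integrable lborel (\<lambda>x. gauss_conv F (r i) x - F x)"
    and "(\<lambda>i. \<integral>x. cmod (gauss_conv F (r i) x - F x) \<partial>lborel) \<longlonglongrightarrow> 0"
proof -
  have Fm [measurable]: "F \<in> borel_measurable borel"
    using F by auto
  have Fy: "integrable lborel (\<lambda>x. F (x + y))" for y
    by (rule integrable_lborel_translate[THEN iffD2, OF Fm F])
  define w where "w y = (\<integral>x. cmod (F (x + y) - F x) \<partial>lborel)" for y
  have [measurable]: "w \<in> borel_measurable borel"
    unfolding w_def[abs_def] by measurable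
  have w: "(\<integral>\<^sup>+x. ennreal (cmod (F (x + y) - F x)) \<partial>lborel) = ennreal (w y)" for y
    unfolding w_def using Fy F by (intro nn_integral_eq_integral) auto
  have w0: "w y \<ge> 0" for y
    by (simp add: w_def)
  define B where "B = 2 * (\<integral>x. cmod (F x) \<partial>lborel)"
  have wB: "w y \<le> B" for y
  proof -
    have "w y \<le> (\<integral>x. cmod (F (x + y)) + cmod (F x) \<partial>lborel)"
      unfolding w_def by (intro integral_mono) (use Fy F in \<open>auto simp: norm_triangle_ineq4\<close>)
    also have "\<dots> = (\<integral>x. cmod (F (x + y)) \<partial>lborel) + (\<integral>x. cmod (F x) \<partial>lborel)"
      using Fy F by (intro Bochner_Integration.integral_add) auto
    also have "(\<integral>x. cmod (F (x + y)) \<partial>lborel) = (\<integral>x. cmod (F x) \<partial>lborel)"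
      by (rule integral_lborel_translate) measurable
    finally show ?thesis
      by (simp add: B_def)
  qed
  have wlim: "(\<lambda>i. w (r i *\<^sub>R z)) \<longlonglongrightarrow> 0" for z
    unfolding w_def
    by (rule L1_translation_continuous[OF F]) (use tendsto_scaleR[OF r(2) tendsto_const[of z]] in simp)
  let ?k = "\<lambda>z::'a. exp (- (norm z)\<^sup>2)"
  have k: "integrable lborel ?k"
    using has_integral_gauss_kernel[of 1, where 'a = 'a] by (auto simp: has_bochner_integral_iff)
  have kw: "integrable lborel (\<lambda>z. ?k z * w (r i *\<^sub>R z))" for i
    by (rule Bochner_Integration.integrable_bound[of _ "\<lambda>z. ?k z * B"])
       (use k wB w0 in \<open>auto intro!: AE_I2 mult_left_mono simp: abs_mult intro: order_trans[OF wB abs_ge_self]\<close>)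
  have lim: "(\<lambda>i. \<integral>z. ?k z * w (r i *\<^sub>R z) \<partial>lborel) \<longlonglongrightarrow> (\<integral>z. (0::real) \<partial>(lborel :: 'a measure))"
  proof (rule integral_dominated_convergence[where w = "\<lambda>z. ?k z * B"])
    show "AE z in lborel. (\<lambda>i. ?k z * w (r i *\<^sub>R z)) \<longlonglongrightarrow> 0"
      by (intro AE_I2 tendsto_mult_right_zero wlim)
    show "AE z in lborel. norm (?k z * w (r i *\<^sub>R z)) \<le> ?k z * B" for i
      using wB w0 by (auto intro!: AE_I2 mult_left_mono simp: abs_mult)
  qed (use k in auto)
  define c where "c = 1 / sqrt pi ^ DIM('a)"
  have c: "c \<ge> 0"
    by (simp add: c_def)
  have bound: "(\<integral>\<^sup>+x. ennreal (cmod (gauss_conv F (r i) x - F x)) \<partial>lborel) \<le>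
      ennreal (c * (\<integral>z. ?k z * w (r i *\<^sub>R z) \<partial>lborel))" for i
  proof -
    have "(\<integral>\<^sup>+x. ennreal (cmod (gauss_conv F (r i) x - F x)) \<partial>lborel) \<le>
        ennreal c * (\<integral>\<^sup>+z. ennreal (?k z) * ennreal (w (r i *\<^sub>R z)) \<partial>lborel)"
      using gauss_conv_diff_le[OF F r(1)[of i]] by (simp add: w c_def)
    also have "(\<integral>\<^sup>+z. ennreal (?k z) * ennreal (w (r i *\<^sub>R z)) \<partial>lborel) =
        (\<integral>\<^sup>+z. ennreal (?k z * w (r i *\<^sub>R z)) \<partial>lborel)"
      by (simp add: ennreal_mult w0)
    also have "\<dots> = ennreal (\<integral>z. ?k z * w (r i *\<^sub>R z) \<partial>lborel)"
      using w0 by (intro nn_integral_eq_integral kw) auto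
    finally show ?thesis
      using c w0 by (simp add: ennreal_mult)
  qed
  show int: "integrable lborel (\<lambda>x. gauss_conv F (r i) x - F x)" for i
    by (rule integrableI_bounded) (use bound[of i] in \<open>auto intro: le_less_trans\<close>)
  have le: "(\<integral>x. cmod (gauss_conv F (r i) x - F x) \<partial>lborel) \<le> c * (\<integral>z. ?k z * w (r i *\<^sub>R z) \<partial>lborel)" for i
    using bound[of i] int[of i] c w0
    by (subst (asm) nn_integral_eq_integral) (auto simp: ennreal_le_iff)
  have lim': "(\<lambda>i. c * (\<integral>z. ?k z * w (r i *\<^sub>R z) \<partial>lborel)) \<longlonglongrightarrow> 0"
    using tendsto_mult_left[OF lim, of c] by simp
  show "(\<lambda>i. \<integral>x. cmod (gauss_conv F (r i) x - F x) \<partial>lborel) \<longlonglongrightarrow> 0"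
    by (rule tendsto_sandwich[OF _ _ tendsto_const lim']; intro always_eventually allI)
       (rule Bochner_Integration.integral_nonneg norm_ge_zero le)+
qed

theorem plancherel:
  fixes F :: "'a::euclidean_space \<Rightarrow> complex"
  assumes F: "integrable lborel F"
  shows "(\<integral>\<^sup>+y. ennreal ((cmod (\<integral>u. F u * exp (\<i> * complex_of_real (y \<bullet> u)) \<partial>lborel))\<^sup>2) \<partial>lborel) =
    ennreal ((2 * pi) ^ DIM('a)) * (\<integral>\<^sup>+u. ennreal ((cmod (F u))\<^sup>2) \<partial>lborel)"
    (is "?X = ennreal ?c * ?Y")
proof (rule antisym)
  have [measurable]: "F \<in> borel_measurable borel"
    using F by auto
  define f where "f y = (cmod (\<integral>u. F u * exp (\<i> * complex_of_real (y \<bullet> u)) \<partial>lborel))\<^sup>2" for y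
  have [measurable]: "f \<in> borel_measurable borel"
    unfolding f_def[abs_def] by measurable
  define r where "r i = 1 / real (Suc i)" for i
  have r: "r i > 0" "r \<longlonglongrightarrow> 0" for i
    using LIMSEQ_inverse_real_of_nat by (simp_all add: r_def[abs_def] inverse_eq_divide)
  define X where "X i = (\<integral>\<^sup>+y. ennreal (f y * exp (- (r i * norm y)\<^sup>2 / 2)) \<partial>lborel)" for i
  have X: "X i = ennreal ?c * (\<integral>\<^sup>+x. ennreal ((cmod (gauss_conv F (r i) x))\<^sup>2) \<partial>lborel)" for i
  proof -
    have "X i = ennreal (\<integral>y. f y * exp (- (r i * norm y)\<^sup>2 / 2) \<partial>lborel)"
      unfolding X_def using integrable_fourier_gauss[OF F r(1)[of i]]
      by (intro nn_integral_eq_integral) (simp_all only: f_def, auto)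
    also have "\<dots> = ennreal ?c * ennreal (\<integral>x. (cmod (gauss_conv F (r i) x))\<^sup>2 \<partial>lborel)"
      unfolding f_def integral_fourier_gauss[OF F r(1)[of i]] by (intro ennreal_mult) auto
    also have "ennreal (\<integral>x. (cmod (gauss_conv F (r i) x))\<^sup>2 \<partial>lborel) =
        (\<integral>\<^sup>+x. ennreal ((cmod (gauss_conv F (r i) x))\<^sup>2) \<partial>lborel)"
      using integrable_gauss_conv_square[OF F r(1)[of i]] by (intro nn_integral_eq_integral[symmetric]) auto
    finally show ?thesis .
  qed
  \<comment> \<open>Upper bound: the weights tend to 1, and each weighted integral is at most
    \<open>?c * ?Y\<close> because Gaussian averaging contracts L^2.\<close>
  have "?X = (\<integral>\<^sup>+y. liminf (\<lambda>i. ennreal (f y * exp (- (r i * norm y)\<^sup>2 / 2))) \<partial>lborel)"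
  proof (intro nn_integral_cong)
    fix y :: 'a
    have "(\<lambda>i. ennreal (f y * exp (- (r i * norm y)\<^sup>2 / 2))) \<longlonglongrightarrow> ennreal (f y * exp (- (0 * norm y)\<^sup>2 / 2))"
      by (intro tendsto_intros r(2)) auto
    from lim_imp_Liminf[OF _ this] show "ennreal ((cmod (\<integral>u. F u * exp (\<i> * complex_of_real (y \<bullet> u)) \<partial>lborel))\<^sup>2) =
        liminf (\<lambda>i. ennreal (f y * exp (- (r i * norm y)\<^sup>2 / 2)))"
      by (simp add: f_def)
  qed
  also have "\<dots> \<le> liminf X"
    unfolding X_def by (rule nn_integral_liminf) measurable
  also have "\<dots> \<le> liminf (\<lambda>_. ennreal ?c * ?Y)"
    unfolding X by (intro Liminf_mono always_eventually allI mult_left_mono nn_integral_gauss_conv_square_le F r) auto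
  also have "\<dots> = ennreal ?c * ?Y"
    by (rule Liminf_const) auto
  finally show "?X \<le> ennreal ?c * ?Y" .

  note L1 = gauss_conv_tendsto_L1[OF F r]
  \<comment> \<open>Lower bound: Fatou needs pointwise convergence of the averages, and L^1
    convergence provides it almost everywhere along a subsequence.\<close>
  obtain s where s: "strict_mono s" "AE x in lborel. (\<lambda>i. gauss_conv F (r (s i)) x - F x) \<longlonglongrightarrow> 0"
    using tendsto_L1_AE_subseq[OF L1] by auto
  have "?Y = (\<integral>\<^sup>+x. liminf (\<lambda>i. ennreal ((cmod (gauss_conv F (r (s i)) x))\<^sup>2)) \<partial>lborel)"
  proof (rule nn_integral_cong_AE, use s(2) in eventually_elim)
    fix x assume "(\<lambda>i. gauss_conv F (r (s i)) x - F x) \<longlonglongrightarrow> 0"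
    then have "(\<lambda>i. ennreal ((cmod (gauss_conv F (r (s i)) x))\<^sup>2)) \<longlonglongrightarrow> ennreal ((cmod (F x))\<^sup>2)"
      by (intro tendsto_ennrealI tendsto_intros) (simp add: LIM_zero_cancel)
    from lim_imp_Liminf[OF _ this]
    show "ennreal ((cmod (F x))\<^sup>2) = liminf (\<lambda>i. ennreal ((cmod (gauss_conv F (r (s i)) x))\<^sup>2))"
      by simp
  qed
  also have "\<dots> \<le> liminf (\<lambda>i. \<integral>\<^sup>+x. ennreal ((cmod (gauss_conv F (r (s i)) x))\<^sup>2) \<partial>lborel)"
    by (rule nn_integral_liminf) measurable
  also have "\<dots> \<le> liminf (\<lambda>_::nat. ennreal (1 / ?c) * ?X)"
  proof (intro Liminf_mono always_eventually allI)
    fix i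
    have "ennreal (1 / ?c) * ennreal ?c = 1"
      by (simp flip: ennreal_mult)
    then have "(\<integral>\<^sup>+x. ennreal ((cmod (gauss_conv F (r (s i)) x))\<^sup>2) \<partial>lborel) = ennreal (1 / ?c) * X (s i)"
      unfolding X mult.assoc[symmetric] by simp
    also have "X (s i) \<le> ?X"
      unfolding X_def f_def by (intro nn_integral_mono ennreal_leI) (simp add: mult_left_le)
    finally show "(\<integral>\<^sup>+x. ennreal ((cmod (gauss_conv F (r (s i)) x))\<^sup>2) \<partial>lborel) \<le> ennreal (1 / ?c) * ?X"
      by (simp add: mult_left_mono)
  qed
  also have "\<dots> = ennreal (1 / ?c) * ?X"
    by (rule Liminf_const) auto
  finally have "ennreal ?c * ?Y \<le> ennreal ?c * (ennreal (1 / ?c) * ?X)"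
    by (rule mult_left_mono) auto
  also have "\<dots> = (ennreal ?c * ennreal (1 / ?c)) * ?X"
    by (simp only: mult.assoc)
  also have "ennreal ?c * ennreal (1 / ?c) = 1"
    by (simp flip: ennreal_mult)
  finally show "ennreal ?c * ?Y \<le> ?X"
    by simp
qed

section \<open>Change of variables\<close>

text \<open>Such a map carries one orthonormal basis onto another, hence boxes to boxes with the
  same side lengths, and boxes determine Lebesgue measure. Domain and codomain may be different
  types, as happens when coordinates are regrouped.\<close>

lemma lborel_distr_Basis:
  fixes f :: "'a::euclidean_space \<Rightarrow> 'b::euclidean_space"
  assumes f: "linear f" and bij: "bij_betw f Basis Basis"
  shows "distr lborel borel f = lborel"
proof (rule lborel_eqI[symmetric])
  have fB: "f b \<in> Basis" if "b \<in> Basis" for b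
    using bij that by (auto simp: bij_betw_def)
  have comp: "f x \<bullet> f b = x \<bullet> b" if b: "b \<in> Basis" for x b
  proof -
    have "f x = (\<Sum>c\<in>Basis. (x \<bullet> c) *\<^sub>R f c)"
      by (subst euclidean_representation[of x, symmetric], subst linear_sum[OF f])
         (simp add: linear_cmul[OF f])
    then have "f x \<bullet> f b = (\<Sum>c\<in>Basis. (x \<bullet> c) * (f c \<bullet> f b))"
      by (simp add: inner_sum_left)
    also have "\<dots> = (\<Sum>c\<in>Basis. (if c = b then x \<bullet> c else 0))"
      using fB b bij by (intro sum.cong refl) (auto simp: inner_Basis bij_betw_def inj_on_def)
    finally show ?thesis
      using b by simp
  qed
  have Basis_eq: "Basis = f ` Basis"
    using bij by (simp add: bij_betw_def)
  have [measurable]: "f \<in> borel_measurable borel"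
    using f by (intro borel_measurable_continuous_onI linear_continuous_on linear_conv_bounded_linear[THEN iffD1])
  show "sets (distr lborel borel f) = sets borel"
    by simp
  fix l u :: 'b
  assume lu: "\<And>b. b \<in> Basis \<Longrightarrow> l \<bullet> b \<le> u \<bullet> b"
  \<comment> \<open>\<open>p\<close> is the transpose of \<open>f\<close>, which here is its
    inverse; it maps the corners of a box to those of its preimage.\<close>
  define p where "p v = (\<Sum>b\<in>Basis. (v \<bullet> f b) *\<^sub>R b)" for v :: 'b
  have p: "p v \<bullet> b = v \<bullet> f b" if "b \<in> Basis" for v b
    using that by (simp add: p_def)
  have "f -` box l u = box (p l) (p u)"
    unfolding box_def by (subst Basis_eq) (auto simp: comp p)
  then have "emeasure (distr lborel borel f) (box l u) = emeasure lborel (box (p l) (p u))"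
    by (subst emeasure_distr) auto
  also have "\<dots> = ennreal (\<Prod>b\<in>Basis. (p u - p l) \<bullet> b)"
    using lu fB by (intro emeasure_lborel_box) (simp add: p)
  also have "(\<Prod>b\<in>Basis. (p u - p l) \<bullet> b) = (\<Prod>b\<in>Basis. (u - l) \<bullet> f b)"
    by (intro prod.cong refl) (simp add: inner_diff_left p)
  also have "\<dots> = (\<Prod>b\<in>Basis. (u - l) \<bullet> b)"
    by (rule prod.reindex_bij_betw[OF bij])
  finally show "emeasure (distr lborel borel f) (box l u) = ennreal (\<Prod>b\<in>Basis. (u - l) \<bullet> b)" .
qed

text \<open>The cylinder over a null set \<open>N\<close> has a measure \<open>?m\<close> that is
  unchanged by shifts in coordinate \<open>j\<close>. Integrating over all shifts \<open>t\<close>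
  gives \<open>?m\<close> times an infinite mass, while exchanging the integrals gives 0, since
  every translate of \<open>N\<close> is null.\<close>

lemma AE_lborel_component:
  fixes P :: "'a::euclidean_space \<Rightarrow> bool" and j :: "'n::finite"
  assumes P: "AE x in lborel. P x"
  shows "AE \<xi> in (lborel :: ('a^'n) measure). P (\<xi> $ j)"
proof -
  obtain N where N: "{x. \<not> P x} \<subseteq> N" "N \<in> null_sets lborel"
    using P by (auto elim!: AE_E simp: null_sets_def)
  have [measurable]: "N \<in> sets borel" and N0: "emeasure lborel N = 0"
    using N by auto
  have [measurable]: "(\<lambda>\<xi>::'a^'n. \<xi> $ j) \<in> borel_measurable borel"
    by (intro borel_measurable_continuous_onI continuous_intros)
  let ?m = "\<integral>\<^sup>+\<xi>. indicator N (\<xi> $ j) \<partial>(lborel :: ('a^'n) measure)"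
  have 1: "(\<integral>\<^sup>+\<xi>. indicator N (\<xi> $ j + t) \<partial>(lborel :: ('a^'n) measure)) = ?m" for t
  proof -
    have "(\<integral>\<^sup>+\<xi>. indicator N (\<xi> $ j) \<partial>(lborel :: ('a^'n) measure)) =
        (\<integral>\<^sup>+\<xi>. indicator N ((axis j t + \<xi>) $ j) \<partial>(lborel :: ('a^'n) measure))"
      by (subst lborel_distr_plus[of "axis j t", symmetric], subst nn_integral_distr) simp_all
    then show ?thesis
      by (simp add: add.commute)
  qed
  have 2: "(\<integral>\<^sup>+t. indicator N (x + t) \<partial>lborel) = (0::ennreal)" for x :: 'a
  proof -
    have "(\<integral>\<^sup>+t. indicator N t \<partial>lborel) = (\<integral>\<^sup>+t. indicator N (x + t) \<partial>(lborel :: 'a measure))"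
      by (subst lborel_distr_plus[of x, symmetric], subst nn_integral_distr) simp_all
    then show ?thesis
      using N0 by simp
  qed
  have "(\<integral>\<^sup>+t. ?m \<partial>(lborel :: 'a measure)) =
      (\<integral>\<^sup>+t. \<integral>\<^sup>+\<xi>. indicator N (\<xi> $ j + t) \<partial>(lborel :: ('a^'n) measure) \<partial>(lborel :: 'a measure))"
    by (simp only: 1)
  also have "\<dots> = (\<integral>\<^sup>+\<xi>. \<integral>\<^sup>+t. indicator N (\<xi> $ j + t) \<partial>(lborel :: 'a measure) \<partial>(lborel :: ('a^'n) measure))"
    by (rule lborel_pair.Fubini') measurable
  also have "\<dots> = 0"
    by (simp only: 2) simp
  finally have "?m = 0"
    by simp
  then have "AE \<xi> in (lborel :: ('a^'n) measure). indicator N (\<xi> $ j) = (0::ennreal)"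
    by (subst (asm) nn_integral_0_iff_AE) auto
  then show ?thesis
    by eventually_elim (use N(1) in \<open>auto split: split_indicator_asm\<close>)
qed

section \<open>The area formula for injective differentiable maps\<close>

text \<open>
  The library proves the change of variables formula only for \<open>real^'n\<close> with a well-ordered index
  type \<open>'n\<close>, hence this copy of an arbitrary finite type carrying an arbitrary well-order.
\<close>

typedef 'a wo_copy = "UNIV :: 'a set"
  morphisms of_wo to_wo by auto

lemma bij_of_wo: "bij of_wo"
  by (rule bij_betwI[where g = to_wo]) (auto simp: of_wo_inverse to_wo_inverse)

instance wo_copy :: (finite) finite
proof
  have "inj (of_wo :: 'a wo_copy \<Rightarrow> 'a)"
    using bij_of_wo by (rule bij_is_inj)
  then show "finite (UNIV :: 'a wo_copy set)"
    by (rule finite_imageD[rotated]) simp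
qed

definition wo_rank :: "'a::finite wo_copy \<Rightarrow> nat" where
  "wo_rank = (SOME f. inj f)"

lemma inj_wo_rank: "inj (wo_rank :: 'a::finite wo_copy \<Rightarrow> nat)"
proof -
  have "\<exists>f :: 'a wo_copy \<Rightarrow> nat. inj f"
    using finite_imp_inj_to_nat_seg[OF finite[of "UNIV :: 'a wo_copy set"]] by blast
  then show ?thesis
    unfolding wo_rank_def by (rule someI_ex)
qed

instantiation wo_copy :: (finite) wellorder
begin

definition "less_eq_wo_copy (x::'a wo_copy) (y::'a wo_copy) \<longleftrightarrow> wo_rank x \<le> wo_rank y"
definition "less_wo_copy (x::'a wo_copy) (y::'a wo_copy) \<longleftrightarrow> wo_rank x < wo_rank y"

instance
proof
  fix P :: "'a wo_copy \<Rightarrow> bool" and a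
  assume step: "\<And>x. (\<And>y. y < x \<Longrightarrow> P y) \<Longrightarrow> P x"
  show "P a"
  proof (induction a rule: measure_induct_rule[of wo_rank])
    case (less x)
    show ?case
      by (rule step, rule less) (simp add: less_wo_copy_def)
  qed
next
  fix x y :: "'a wo_copy"
  assume "x \<le> y" "y \<le> x"
  then show "x = y"
    unfolding less_eq_wo_copy_def by (intro injD[OF inj_wo_rank] antisym)
qed (simp_all add: less_eq_wo_copy_def less_wo_copy_def less_le_not_le nat_le_linear)

end

text \<open>Conjugation with \<open>h\<close> is a bijection between the permutations of the two
  index types and preserves the sign.\<close>

lemma det_reindex:
  fixes A :: "'c::comm_ring_1^'a::finite^'a" and h :: "'b::finite \<Rightarrow> 'a"
  assumes h: "bij h"
  shows "det (\<chi> i j. A $ h i $ h j) = det A"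
proof -
  have inv: "h (inv h x) = x" "inv h (h y) = y" for x y
    using h by (auto simp: bij_def surj_f_inv_f)
  define c where "c p = map_permutation UNIV h p" for p
  have c_apply: "c p (h i) = h (p i)" for p i
    using h by (simp add: c_def map_permutation_apply bij_is_inj)
  have bij: "bij_betw c {p. p permutes UNIV} {p. p permutes UNIV}"
  proof (rule bij_betwI[where g = "map_permutation UNIV (inv h)"])
    show "c \<in> {p. p permutes UNIV} \<rightarrow> {p. p permutes UNIV}"
      using map_permutation_permutes[OF h] by (auto simp: c_def)
    show "map_permutation UNIV (inv h) \<in> {p. p permutes UNIV} \<rightarrow> {p. p permutes UNIV}"
      using map_permutation_permutes[OF bij_imp_bij_inv[OF h]] by auto
    show "map_permutation UNIV (inv h) (c p) = p" if "p \<in> {p. p permutes UNIV}" for p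
      unfolding c_def by (rule map_permutation_compose_inv[OF h]) (use that inv in auto)
    show "c (map_permutation UNIV (inv h) p) = p" if "p \<in> {p. p permutes UNIV}" for p
      unfolding c_def by (rule map_permutation_compose_inv[OF bij_imp_bij_inv[OF h]]) (use that inv in auto)
  qed
  have "det A = (\<Sum>p | p permutes UNIV. of_int (sign (c p)) * (\<Prod>i\<in>UNIV. A $ i $ c p i))"
    unfolding det_def by (rule sum.reindex_bij_betw[OF bij, symmetric])
  also have "\<dots> = (\<Sum>p | p permutes UNIV. of_int (sign p) * (\<Prod>i\<in>UNIV. A $ h i $ h (p i)))"
  proof (intro sum.cong refl)
    fix p :: "'b \<Rightarrow> 'b" assume "p \<in> {p. p permutes UNIV}"
    then have "sign (c p) = sign p"
      using h by (auto simp: c_def intro!: sign_map_permutation bij_is_inj)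
    moreover have "(\<Prod>i\<in>UNIV. A $ i $ c p i) = (\<Prod>i\<in>UNIV. A $ h i $ c p (h i))"
      by (rule prod.reindex_bij_betw[symmetric]) (use h in simp)
    ultimately show "of_int (sign (c p)) * (\<Prod>i\<in>UNIV. A $ i $ c p i) =
        of_int (sign p) * (\<Prod>i\<in>UNIV. A $ h i $ h (p i))"
      by (simp add: c_apply)
  qed
  finally show ?thesis
    by (simp add: det_def)
qed

text \<open>\<open>has_measure_differentiable_image\<close> is an equivalence between two assertions
  about finite values. Read one way it gives the measure of the image when the integral is finite;
  read the other way it shows that an infinite integral excludes a finite measure of the
  image.\<close>

lemma emeasure_differentiable_image_wellorder:
  fixes f :: "real^'n::{finite,wellorder} \<Rightarrow> real^'n::_"
  assumes S: "S \<in> sets borel" and fS: "f ` S \<in> sets borel"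
    and der: "\<And>x. x \<in> S \<Longrightarrow> (f has_derivative f' x) (at x)"
    and inj: "inj_on f S"
    and meas: "(\<lambda>x. \<bar>det (matrix (f' x))\<bar>) \<in> borel_measurable borel"
  shows "emeasure lborel (f ` S) = (\<integral>\<^sup>+x. ennreal \<bar>det (matrix (f' x))\<bar> * indicator S x \<partial>lborel)"
proof -
  let ?J = "\<lambda>x. \<bar>det (matrix (f' x))\<bar>"
  let ?I = "\<integral>\<^sup>+x. ennreal (?J x) * indicator S x \<partial>lborel"
  note [measurable] = S fS meas
  have Sl: "S \<in> sets lebesgue"
    using S by simp
  note image = has_measure_differentiable_image[OF Sl has_derivative_at_withinI[OF der] inj]
  show ?thesis
  proof (cases "?I < \<infinity>")
    case True
    then obtain m where m: "?I = ennreal m" "m \<ge> 0"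
      by (cases ?I) auto
    have "(\<integral>\<^sup>+x. ennreal (?J x * indicator S x) \<partial>lborel) = ennreal m"
      by (subst m(1)[symmetric], intro nn_integral_cong) (auto split: split_indicator)
    then have "((\<lambda>x. ?J x * indicator S x) has_integral m) UNIV"
      using m(2) by (intro nn_integral_has_integral) auto
    also have "(\<lambda>x. ?J x * indicator S x) = (\<lambda>x. if x \<in> S then ?J x else 0)"
      by auto
    finally have "(?J has_integral m) S"
      by (simp only: has_integral_restrict_UNIV)
    then have "f ` S \<in> lmeasurable" "measure lebesgue (f ` S) = m"
      using image by auto
    then have "emeasure lebesgue (f ` S) = ennreal m"
      by (simp add: emeasure_eq_measure2)
    then show ?thesis
      using m by simp
  next
    case False
    have "emeasure lborel (f ` S) = \<infinity>"
    proof (rule ccontr)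
      assume "emeasure lborel (f ` S) \<noteq> \<infinity>"
      then have "f ` S \<in> lmeasurable"
        by (auto simp: fmeasurable_def top.not_eq_extremum)
      then have "(?J has_integral measure lebesgue (f ` S)) S"
        using image by auto
      then have "?I = ennreal (measure lebesgue (f ` S))"
        by (intro nn_integral_has_integral_lebesgue') auto
      then show False
        using False by simp
    qed
    then show ?thesis
      using False by (metis infinity_ennreal_def top.not_eq_extremum)
  qed
qed

text \<open>Relabelling the coordinates preserves Lebesgue measure and, by
  \<open>det_reindex\<close>, the Jacobian, so the formula passes to any finite index type.\<close>

lemma emeasure_differentiable_image:
  fixes f :: "real^'n::finite \<Rightarrow> real^'n"
  assumes S: "S \<in> sets borel" and fS: "f ` S \<in> sets borel"
    and der: "\<And>x. x \<in> S \<Longrightarrow> (f has_derivative f' x) (at x)"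
    and inj: "inj_on f S"
    and meas: "(\<lambda>x. \<bar>det (matrix (f' x))\<bar>) \<in> borel_measurable borel"
  shows "emeasure lborel (f ` S) = (\<integral>\<^sup>+x. ennreal \<bar>det (matrix (f' x))\<bar> * indicator S x \<partial>lborel)"
proof -
  note [measurable] = S fS meas
  define P :: "real^'n wo_copy \<Rightarrow> real^'n" where "P v = (\<chi> i. v $ to_wo i)" for v
  define Q :: "real^'n \<Rightarrow> real^'n wo_copy" where "Q v = (\<chi> i. v $ of_wo i)" for v
  have PQ: "P (Q v) = v" "Q (P u) = u" for u v
    by (simp_all add: P_def Q_def vec_eq_iff of_wo_inverse to_wo_inverse)
  have linP: "linear P" and linQ: "linear Q"
    by (auto simp: linear_iff P_def Q_def vec_eq_iff)
  then have blP: "bounded_linear P" and blQ: "bounded_linear Q"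
    by (simp_all add: linear_conv_bounded_linear)
  have [measurable]: "P \<in> borel_measurable borel" "Q \<in> borel_measurable borel"
    using blP blQ by (auto intro!: borel_measurable_continuous_onI linear_continuous_on)
  have P_axis: "P (axis i 1) = axis (of_wo i) 1" for i
    by (auto simp: P_def axis_def vec_eq_iff of_wo_inverse to_wo_inverse)
  have Q_axis: "Q (axis i 1) = axis (to_wo i) 1" for i
    by (auto simp: Q_def axis_def vec_eq_iff of_wo_inverse to_wo_inverse)
  have "bij_betw P Basis Basis"
    by (rule bij_betwI[where g = Q]) (auto simp: Basis_vec_def PQ P_axis Q_axis)
  then have P: "distr lborel borel P = lborel"
    by (rule lborel_distr_Basis[OF linP])
  define g where "g = Q \<circ> f \<circ> P"
  define g' where "g' x = Q \<circ> f' (P x) \<circ> P" for x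
  define T where "T = P -` S"
  have T [measurable]: "T \<in> sets borel"
    using measurable_sets[of P borel borel S] by (simp add: T_def)
  have PT: "P ` T = S"
    unfolding T_def using PQ by (metis surjI surj_image_vimage_eq)
  have QP: "Q ` A = P -` A" for A
    using PQ by (auto intro: image_eqI[where x = "P _"])
  have gT: "g ` T = P -` (f ` S)"
    unfolding g_def image_comp[symmetric] PT QP ..
  have gT': "g ` T \<in> sets borel"
    using measurable_sets[of P borel borel "f ` S"] by (simp add: gT)
  have det: "det (matrix (g' x)) = det (matrix (f' (P x)))" for x
  proof -
    have "matrix (g' x) = (\<chi> i j. matrix (f' (P x)) $ of_wo i $ of_wo j)"
      by (simp add: matrix_def g'_def P_axis vec_eq_iff) (simp add: Q_def)
    then show ?thesis
      using det_reindex[OF bij_of_wo, of "matrix (f' (P x))"] by simp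
  qed
  have "emeasure lborel (f ` S) = emeasure lborel (g ` T)"
    by (subst P[symmetric], subst emeasure_distr) (simp_all add: gT)
  also have "\<dots> = (\<integral>\<^sup>+x. ennreal \<bar>det (matrix (g' x))\<bar> * indicator T x \<partial>lborel)"
  proof (rule emeasure_differentiable_image_wellorder[OF T gT'])
    show "inj_on g T"
    proof (rule inj_onI)
      fix x y assume xy: "x \<in> T" "y \<in> T" "g x = g y"
      then have "f (P x) = f (P y)"
        unfolding g_def by (metis PQ(1) comp_apply)
      then have "P x = P y"
        using inj xy by (auto simp: T_def inj_on_def)
      then show "x = y"
        by (metis PQ(2))
    qed
    show "(\<lambda>x. \<bar>det (matrix (g' x))\<bar>) \<in> borel_measurable borel"
      unfolding det by measurable
    fix x assume "x \<in> T"
    then have "(f has_derivative f' (P x)) (at (P x))"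
      by (intro der) (simp add: T_def)
    from has_derivative_compose[OF bounded_linear_imp_has_derivative[OF blP] this]
    have "((\<lambda>x. f (P x)) has_derivative (\<lambda>h. f' (P x) (P h))) (at x)" .
    from bounded_linear.has_derivative[OF blQ this]
    show "(g has_derivative g' x) (at x)"
      by (simp add: g_def g'_def comp_def)
  qed
  also have "\<dots> = (\<integral>\<^sup>+x. ennreal \<bar>det (matrix (f' (P x)))\<bar> * indicator S (P x) \<partial>lborel)"
    by (simp add: det T_def indicator_vimage[symmetric] vimage_def indicator_def)
  also have "\<dots> = (\<integral>\<^sup>+x. ennreal \<bar>det (matrix (f' x))\<bar> * indicator S x \<partial>lborel)"
    by (subst P[symmetric], subst nn_integral_distr) simp_all
  finally show ?thesis .
qed

text \<open>Continuous images of Borel sets need not be Borel. With injectivity, the inverse is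
  continuous on the image of each compact piece \<open>K n\<close>, and the image of
  \<open>A \<inter> K n\<close> is the preimage of \<open>A\<close> under this inverse; countably
  many pieces exhaust \<open>S\<close>.\<close>

lemma borel_injective_image:
  fixes f :: "'a::euclidean_space \<Rightarrow> 'b::euclidean_space"
  assumes S: "closed S" and f: "continuous_on S f" "inj_on f S" and A: "A \<in> sets borel" "A \<subseteq> S"
  shows "f ` A \<in> sets borel"
proof -
  define K where "K n = S \<inter> cball 0 (real n)" for n :: nat
  have K: "compact (K n)" "K n \<subseteq> S" for n
    using S by (auto simp: K_def closed_Int_compact)
  have "f ` (A \<inter> K n) \<in> sets borel" for n
  proof -
    have fK: "compact (f ` K n)"
      using K f by (intro compact_continuous_image) (auto intro: continuous_on_subset)
    have inj: "inj_on f (K n)"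
      using f(2) K(2) by (rule inj_on_subset)
    have "continuous_on (f ` K n) (inv_into (K n) f)"
      using K f by (intro continuous_on_inv) (auto intro: continuous_on_subset simp: inj)
    then have "inv_into (K n) f -` A \<inter> space (restrict_space borel (f ` K n)) \<in> sets (restrict_space borel (f ` K n))"
      by (intro measurable_sets[OF borel_measurable_continuous_on_restrict A(1)])
    also have "inv_into (K n) f -` A \<inter> space (restrict_space borel (f ` K n)) = f ` (A \<inter> K n)"
      using inj by (auto simp: space_restrict_space)
    finally show ?thesis
      using compact_imp_closed[OF fK] by (subst (asm) sets_restrict_space_iff) auto
  qed
  then have "(\<Union>n. f ` (A \<inter> K n)) \<in> sets borel"
    by blast
  also have "(\<Union>n. f ` (A \<inter> K n)) = f ` A"
  proof (intro set_eqI iffI)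
    fix y assume "y \<in> f ` A"
    then obtain x where x: "x \<in> A" "y = f x"
      by auto
    obtain n where "norm x \<le> real n"
      using real_arch_simple by blast
    then have "x \<in> A \<inter> K n"
      using x A by (auto simp: K_def)
    then show "y \<in> (\<Union>n. f ` (A \<inter> K n))"
      using x by blast
  qed auto
  finally show ?thesis .
qed

section \<open>Plancherel's theorem for a nonlinear phase\<close>

text \<open>\<open>J\<close> stands for the Jacobian of \<Phi>. By \<open>area\<close>, \<Phi> maps
  the measure with density \<open>J\<close> on \<open>S\<close> to Lebesgue measure on the image of
  \<open>S\<close>. With \<open>G (\<Phi> \<xi>) = h \<xi> / J \<xi>\<close> the oscillatory
  integral of \<open>h\<close> becomes the ordinary Fourier transform of \<open>G\<close>; on the
  way back the squared quotient meets one factor \<open>J\<close>.\<close>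

lemma oscillatory_plancherel:
  fixes \<Phi> :: "'a::euclidean_space \<Rightarrow> 'b::euclidean_space" and h :: "'a \<Rightarrow> complex" and J :: "'a \<Rightarrow> real"
  assumes S: "closed S" and cont: "continuous_on UNIV \<Phi>" and inj: "inj_on \<Phi> S"
    and J [measurable]: "J \<in> borel_measurable borel" and pos: "\<And>\<xi>. \<xi> \<in> S \<Longrightarrow> J \<xi> > 0"
    and area: "\<And>A. A \<in> sets borel \<Longrightarrow> A \<subseteq> S \<Longrightarrow>
      emeasure lborel (\<Phi> ` A) = (\<integral>\<^sup>+\<xi>. ennreal (J \<xi>) * indicator A \<xi> \<partial>lborel)"
    and h: "integrable lborel h" "\<And>\<xi>. \<xi> \<notin> S \<Longrightarrow> h \<xi> = 0"
  shows "(\<integral>\<^sup>+y. ennreal ((cmod (\<integral>\<xi>. h \<xi> * exp (\<i> * complex_of_real (y \<bullet> \<Phi> \<xi>)) \<partial>lborel))\<^sup>2) \<partial>lborel) =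
    ennreal ((2 * pi) ^ DIM('b)) * (\<integral>\<^sup>+\<xi>. ennreal ((cmod (h \<xi>))\<^sup>2 / J \<xi>) \<partial>lborel)"
proof -
  have [measurable]: "S \<in> sets borel" "h \<in> borel_measurable borel" "\<Phi> \<in> borel_measurable borel"
    using S h cont by (auto intro: borel_measurable_continuous_onI)
  have image [measurable]: "\<Phi> ` A \<in> sets borel" if "A \<in> sets borel" "A \<subseteq> S" for A
    using borel_injective_image[OF S continuous_on_subset[OF cont] inj that] by simp
  have \<Phi>S [measurable]: "\<Phi> ` S \<in> sets borel"
    by (rule image) auto
  \<comment> \<open>\<open>J\<close> is known to be positive only on \<open>S\<close>; the cut-off
    makes the density nonnegative everywhere.\<close>
  define j where "j \<xi> = J \<xi> * indicator S \<xi>" for \<xi>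
  have [measurable]: "j \<in> borel_measurable borel"
    unfolding j_def[abs_def] by measurable
  have j: "j \<xi> \<ge> 0" for \<xi>
    using pos[of \<xi>] by (auto simp: j_def split: split_indicator)
  define M where "M = density lborel (\<lambda>\<xi>. ennreal (j \<xi>))"
  have [measurable_cong, simp]: "sets M = sets borel"
    by (simp add: M_def)
  have push: "distr M borel \<Phi> = density lborel (\<lambda>u. ennreal (indicator (\<Phi> ` S) u))"
  proof (rule measure_eqI)
    fix B assume "B \<in> sets (distr M borel \<Phi>)"
    then have B [measurable]: "B \<in> sets borel"
      by simp
    have \<Phi>B [measurable]: "\<Phi> -` B \<in> sets borel"
      using measurable_sets[of \<Phi> borel borel B] by simp
    have "emeasure (distr M borel \<Phi>) B = emeasure M (\<Phi> -` B)"
      by (subst emeasure_distr) (auto simp: M_def)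
    also have "\<dots> = (\<integral>\<^sup>+\<xi>. ennreal (J \<xi>) * indicator (S \<inter> \<Phi> -` B) \<xi> \<partial>lborel)"
      unfolding M_def by (subst emeasure_density)
        (auto simp: j_def intro!: nn_integral_cong split: split_indicator)
    also have "\<dots> = emeasure lborel (\<Phi> ` (S \<inter> \<Phi> -` B))"
      by (rule area[symmetric]) auto
    also have "\<Phi> ` (S \<inter> \<Phi> -` B) = \<Phi> ` S \<inter> B"
      by auto
    also have "emeasure lborel \<dots> = (\<integral>\<^sup>+u. indicator (\<Phi> ` S \<inter> B) u \<partial>lborel)"
      by simp
    also have "\<dots> = emeasure (density lborel (\<lambda>u. ennreal (indicator (\<Phi> ` S) u))) B"
      by (subst emeasure_density, simp, simp, intro nn_integral_cong) (auto split: split_indicator)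
    finally show "emeasure (distr M borel \<Phi>) B = emeasure (density lborel (\<lambda>u. ennreal (indicator (\<Phi> ` S) u))) B" .
  qed simp
  define q where "q \<xi> = h \<xi> / complex_of_real (J \<xi>)" for \<xi>
  have [measurable]: "q \<in> borel_measurable borel"
    unfolding q_def[abs_def] by measurable
  define G where "G u = (if u \<in> \<Phi> ` S then q (inv_into S \<Phi> u) else 0)" for u
  have G\<Phi>: "G (\<Phi> \<xi>) = q \<xi>" if "\<xi> \<in> S" for \<xi>
    using that inj by (simp add: G_def)
  have G0: "indicator (\<Phi> ` S) u *\<^sub>R G u = G u" for u
    by (simp add: G_def)
  have jG: "j \<xi> *\<^sub>R G (\<Phi> \<xi>) = h \<xi>" for \<xi>
  proof (cases "\<xi> \<in> S")
    case True
    then show ?thesis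
      using pos[OF True] by (simp add: G\<Phi> j_def q_def scaleR_conv_of_real)
  qed (simp add: j_def h)
  have [measurable]: "G \<in> borel_measurable borel"
  proof (rule borel_measurableI)
    fix B :: "complex set" assume "open B"
    then have [measurable]: "q -` B \<in> sets borel"
      using measurable_sets[of q borel borel B] by simp
    \<comment> \<open>The complement appears when \<open>0 \<in> B\<close> because \<open>G\<close>
      is extended by 0 off the image of \<open>S\<close>.\<close>
    have "G -` B = \<Phi> ` (S \<inter> q -` B) \<union> (if 0 \<in> B then - (\<Phi> ` S) else {})"
    proof (rule set_eqI)
      fix u
      show "u \<in> G -` B \<longleftrightarrow> u \<in> \<Phi> ` (S \<inter> q -` B) \<union> (if 0 \<in> B then - (\<Phi> ` S) else {})"
      proof (cases "u \<in> \<Phi> ` S")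
        case True
        then obtain \<xi> where "\<xi> \<in> S" "u = \<Phi> \<xi>"
          by auto
        then show ?thesis
          using inj_on_image_mem_iff[OF inj, of \<xi> "S \<inter> q -` B"] by (simp add: G\<Phi>)
      qed (auto simp: G_def)
    qed
    also have "\<dots> \<in> sets borel"
      using image[of "S \<inter> q -` B"] by (auto intro: borel_comp)
    finally show "G -` B \<inter> space borel \<in> sets borel"
      by simp
  qed
  \<comment> \<open>With \<open>k\<close> constantly 1 this yields the integrability of
    \<open>G\<close>, with \<open>k\<close> an exponential the equality of the two
    transforms.\<close>
  have int: "integrable lborel (\<lambda>u. G u * k u) \<longleftrightarrow> integrable lborel (\<lambda>\<xi>. h \<xi> * k (\<Phi> \<xi>))"
    and integral: "(\<integral>u. G u * k u \<partial>lborel) = (\<integral>\<xi>. h \<xi> * k (\<Phi> \<xi>) \<partial>lborel)"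
    if [measurable]: "k \<in> borel_measurable borel" for k
  proof -
    let ?g = "\<lambda>u. G u * k u"
    have 1: "indicator (\<Phi> ` S) u *\<^sub>R ?g u = ?g u" for u
      using G0[of u] by (metis mult_scaleR_left)
    have 2: "j \<xi> *\<^sub>R ?g (\<Phi> \<xi>) = h \<xi> * k (\<Phi> \<xi>)" for \<xi>
      using jG[of \<xi>] by (metis mult_scaleR_left)
    have "integrable lborel ?g \<longleftrightarrow> integrable (density lborel (\<lambda>u. ennreal (indicator (\<Phi> ` S) u))) ?g"
      by (subst integrable_density) (simp_all only: 1, auto)
    also have "\<dots> \<longleftrightarrow> integrable M (\<lambda>\<xi>. ?g (\<Phi> \<xi>))"
      unfolding push[symmetric] by (rule integrable_distr_eq) measurable
    also have "\<dots> \<longleftrightarrow> integrable lborel (\<lambda>\<xi>. h \<xi> * k (\<Phi> \<xi>))"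
      unfolding M_def using j by (subst integrable_density) (simp_all only: 2, auto)
    finally show "integrable lborel ?g \<longleftrightarrow> integrable lborel (\<lambda>\<xi>. h \<xi> * k (\<Phi> \<xi>))" .
    have "integral\<^sup>L lborel ?g = integral\<^sup>L (density lborel (\<lambda>u. ennreal (indicator (\<Phi> ` S) u))) ?g"
      by (subst integral_density) (simp_all only: 1, auto)
    also have "\<dots> = integral\<^sup>L M (\<lambda>\<xi>. ?g (\<Phi> \<xi>))"
      unfolding push[symmetric] by (rule integral_distr) measurable
    also have "\<dots> = (\<integral>\<xi>. h \<xi> * k (\<Phi> \<xi>) \<partial>lborel)"
      unfolding M_def using j by (subst integral_density) (simp_all only: 2, auto)
    finally show "integral\<^sup>L lborel ?g = (\<integral>\<xi>. h \<xi> * k (\<Phi> \<xi>) \<partial>lborel)" .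
  qed
  have "(\<integral>\<^sup>+y. ennreal ((cmod (\<integral>\<xi>. h \<xi> * exp (\<i> * complex_of_real (y \<bullet> \<Phi> \<xi>)) \<partial>lborel))\<^sup>2) \<partial>lborel) =
      (\<integral>\<^sup>+y. ennreal ((cmod (\<integral>u. G u * exp (\<i> * complex_of_real (y \<bullet> u)) \<partial>lborel))\<^sup>2) \<partial>lborel)"
    by (subst integral) auto
  also have "\<dots> = ennreal ((2 * pi) ^ DIM('b)) * (\<integral>\<^sup>+u. ennreal ((cmod (G u))\<^sup>2) \<partial>lborel)"
    using int[of "\<lambda>_. 1"] h by (intro plancherel) simp
  also have "(\<integral>\<^sup>+u. ennreal ((cmod (G u))\<^sup>2) \<partial>lborel) =
      (\<integral>\<^sup>+u. ennreal ((cmod (G u))\<^sup>2) \<partial>density lborel (\<lambda>u. ennreal (indicator (\<Phi> ` S) u)))"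
    by (subst nn_integral_density, simp, simp, intro nn_integral_cong)
       (auto simp: G_def split: split_indicator)
  also have "\<dots> = (\<integral>\<^sup>+\<xi>. ennreal ((cmod (G (\<Phi> \<xi>)))\<^sup>2) \<partial>M)"
    unfolding push[symmetric] by (rule nn_integral_distr) measurable
  also have "\<dots> = (\<integral>\<^sup>+\<xi>. ennreal (j \<xi>) * ennreal ((cmod (G (\<Phi> \<xi>)))\<^sup>2) \<partial>lborel)"
    unfolding M_def by (rule nn_integral_density) measurable
  also have "\<dots> = (\<integral>\<^sup>+\<xi>. ennreal ((cmod (h \<xi>))\<^sup>2 / J \<xi>) \<partial>lborel)"
  proof (intro nn_integral_cong)
    fix \<xi>
    have "j \<xi> * (cmod (G (\<Phi> \<xi>)))\<^sup>2 = (cmod (h \<xi>))\<^sup>2 / J \<xi>"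
    proof (cases "\<xi> \<in> S")
      case True
      then show ?thesis
        using pos[OF True]
        by (simp add: G\<Phi> j_def q_def norm_divide power_divide power2_eq_square)
    qed (simp add: j_def h)
    then show "ennreal (j \<xi>) * ennreal ((cmod (G (\<Phi> \<xi>)))\<^sup>2) = ennreal ((cmod (h \<xi>))\<^sup>2 / J \<xi>)"
      using j[of \<xi>] by (simp flip: ennreal_mult)
  qed
  finally show ?thesis .
qed

text \<open>The map fixes \<open>w\<close>, so by Fubini its image is measured slice by slice and
  only the derivative in \<open>t\<close> enters. In matrix terms the full derivative would be block
  triangular with an identity block.\<close>

lemma emeasure_fibred_image:
  fixes \<Psi> :: "'w::euclidean_space \<Rightarrow> real^'m::finite \<Rightarrow> real^'m"
  assumes Z: "Z \<in> sets borel" and image: "(\<lambda>p. (fst p, \<Psi> (fst p) (snd p))) ` Z \<in> sets borel"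
    and der: "\<And>w t. (w, t) \<in> Z \<Longrightarrow> (\<Psi> w has_derivative \<Psi>' w t) (at t)"
    and inj: "\<And>w. inj_on (\<Psi> w) {t. (w, t) \<in> Z}"
    and meas: "(\<lambda>p. \<bar>det (matrix (\<Psi>' (fst p) (snd p)))\<bar>) \<in> borel_measurable borel"
  shows "emeasure lborel ((\<lambda>p. (fst p, \<Psi> (fst p) (snd p))) ` Z) =
    (\<integral>\<^sup>+p. ennreal \<bar>det (matrix (\<Psi>' (fst p) (snd p)))\<bar> * indicator Z p \<partial>lborel)"
proof -
  let ?Y = "(\<lambda>p. (fst p, \<Psi> (fst p) (snd p))) ` Z"
  have slice: "Pair w -` A \<in> sets borel" if "A \<in> sets borel" for w and A :: "('w \<times> (real^'m)) set"
    by (rule sets_Pair1[where ?M1.0 = borel]) (use that in \<open>simp only: borel_prod\<close>)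
  have slice_image: "Pair w -` ?Y = \<Psi> w ` {t. (w, t) \<in> Z}" for w
    by force
  have meas' [measurable]: "(\<lambda>p. \<bar>det (matrix (\<Psi>' (fst p) (snd p)))\<bar>) \<in> borel_measurable (borel \<Otimes>\<^sub>M borel)"
      "Z \<in> sets (borel \<Otimes>\<^sub>M borel)"
    using meas Z unfolding borel_prod by blast+
  have meas_slice: "(\<lambda>t. \<bar>det (matrix (\<Psi>' w t))\<bar>) \<in> borel_measurable borel" for w
    using measurable_compose[OF measurable_Pair1'[of w borel borel] meas'(1)] by simp
  have "emeasure lborel ?Y = (\<integral>\<^sup>+w. emeasure lborel (Pair w -` ?Y) \<partial>lborel)"
    by (subst lborel_prod[symmetric], rule lborel.emeasure_pair_measure_alt)
       (use image in \<open>simp only: lborel_prod sets_lborel\<close>)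
  also have "\<dots> = (\<integral>\<^sup>+w. \<integral>\<^sup>+t. ennreal \<bar>det (matrix (\<Psi>' w t))\<bar> * indicator {t. (w, t) \<in> Z} t \<partial>lborel \<partial>lborel)"
    unfolding slice_image
  proof (intro nn_integral_cong emeasure_differentiable_image inj meas_slice der)
    show "{t. (w, t) \<in> Z} \<in> sets borel" for w
      using slice[OF Z, of w] by (simp add: vimage_def)
    show "\<Psi> w ` {t. (w, t) \<in> Z} \<in> sets borel" for w
      using slice[OF image, of w] by (simp only: slice_image)
  qed auto
  also have "\<dots> = (\<integral>\<^sup>+w. \<integral>\<^sup>+t. ennreal \<bar>det (matrix (\<Psi>' w t))\<bar> * indicator Z (w, t) \<partial>lborel \<partial>lborel)"
    by (simp add: indicator_def)
  also have "\<dots> = (\<integral>\<^sup>+p. ennreal \<bar>det (matrix (\<Psi>' (fst p) (snd p)))\<bar> * indicator Z p \<partial>lborel)"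
    unfolding lborel_prod[symmetric] by (subst lborel.nn_integral_fst[symmetric]) simp_all
  finally show ?thesis .
qed

section \<open>The phase map\<close>

lemma det_subtract_row:
  fixes A :: "real^'n::finite^'n"
  assumes "finite K" "l \<notin> K"
  shows "det (\<chi> j. if j \<in> K then row j A - row l A else row j A) = det A"
  using assms
proof (induction K)
  case empty
  then show ?case
    by (simp add: row_def)
next
  case (insert k K)
  let ?A = "\<chi> j. if j \<in> K then row j A - row l A else row j A"
  have "(\<chi> j. if j \<in> insert k K then row j A - row l A else row j A) =
      (\<chi> j. if j = k then row k ?A + (- 1) *s row l ?A else row j ?A)"
    using insert by (auto simp: vec_eq_iff row_def)
  moreover have "k \<noteq> l"
    using insert by auto
  ultimately show ?case
    using insert det_row_operation[of k l ?A "- 1"] by simp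
qed

text \<open>After a transposition, row \<open>None\<close> is subtracted from the others, so that
  column \<open>None\<close> becomes a unit vector. Only the permutations fixing \<open>None\<close>
  survive in the Leibniz sum, and they correspond to the permutations of \<open>'m\<close> with the
  same sign.\<close>

lemma det_bordered:
  fixes a :: "'m::finite option \<Rightarrow> real^'m"
  shows "det (\<chi> i j. (case i of None \<Rightarrow> 1 | Some k \<Rightarrow> a j $ k) :: real^('m option)^('m option)) =
    det (\<chi> k l. (a (Some k) - a None) $ l)"
proof -
  define A :: "real^('m option)^('m option)" where
    "A = (\<chi> j i. case i of None \<Rightarrow> 1 | Some k \<Rightarrow> a j $ k)"
  define C :: "real^('m option)^('m option)" where
    "C = (\<chi> j. if j \<in> range Some then row j A - row None A else row j A)"
  have C_None: "C $ None $ None = 1" "C $ Some k $ None = 0" for k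
    by (simp_all add: C_def A_def row_def)
  have C_Some: "C $ Some k $ Some l = (a (Some k) - a None) $ l" for k l
    by (simp add: C_def A_def row_def)
  let ?sgn = "\<lambda>p. real_of_int (sign p)"
  have "det (\<chi> i j. (case i of None \<Rightarrow> 1 | Some k \<Rightarrow> a j $ k) :: real^('m option)^('m option)) = det (transpose A)"
    by (simp add: A_def transpose_def)
  also have "\<dots> = det C"
    unfolding C_def by (subst det_subtract_row) auto
  also have "\<dots> = (\<Sum>p | p permutes UNIV. ?sgn p * (\<Prod>i\<in>UNIV. C $ i $ p i))"
    by (simp add: det_def)
  also have "\<dots> = (\<Sum>p | p permutes range Some. ?sgn p * (\<Prod>i\<in>UNIV. C $ i $ p i))"
  proof (rule sum.mono_neutral_right)
    show "{p. p permutes range Some} \<subseteq> {p. p permutes (UNIV :: 'm option set)}"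
      by (auto intro: permutes_subset)
    show "\<forall>p\<in>{p. p permutes UNIV} - {p. p permutes range Some}. ?sgn p * (\<Prod>i\<in>UNIV. C $ i $ p i) = 0"
    proof
      fix p :: "'m option \<Rightarrow> 'm option"
      assume "p \<in> {p. p permutes UNIV} - {p. p permutes range Some}"
      then have p: "p permutes UNIV" "\<not> p permutes range Some"
        by auto
      then have "p None \<noteq> None"
        using permutes_superset[OF p(1), of "range Some"] by (auto simp: notin_range_Some)
      moreover obtain i where i: "p i = None"
        using permutes_surj[OF p(1)] by (metis surjD)
      ultimately obtain k where "i = Some k"
        by (cases i) auto
      with i have "C $ i $ p i = 0"
        by (simp add: C_None)
      then have "(\<Prod>i\<in>UNIV. C $ i $ p i) = 0"
        by (intro prod_zero) auto
      then show "?sgn p * (\<Prod>i\<in>UNIV. C $ i $ p i) = 0"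
        by simp
    qed
  qed simp
  also have "\<dots> = (\<Sum>q | q permutes UNIV. ?sgn (map_permutation UNIV Some q) *
      (\<Prod>i\<in>UNIV. C $ i $ map_permutation UNIV Some q i))"
  proof (rule sum.reindex_bij_betw[symmetric])
    have Some: "bij_betw Some UNIV (range (Some :: 'm \<Rightarrow> 'm option))"
      by (simp add: bij_betw_def)
    have the: "bij_betw the (range Some) (UNIV :: 'm set)"
      by (rule bij_betwI[where g = Some]) auto
    show "bij_betw (map_permutation UNIV Some) {q. q permutes (UNIV :: 'm set)} {p. p permutes range Some}"
    proof (rule bij_betwI[where g = "map_permutation (range Some) the"])
      show "map_permutation UNIV Some \<in> {q. q permutes (UNIV :: 'm set)} \<rightarrow> {p. p permutes range Some}"
        using map_permutation_permutes[OF Some] by auto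
      show "map_permutation (range Some) the \<in> {p. p permutes range Some} \<rightarrow> {q. q permutes (UNIV :: 'm set)}"
        using map_permutation_permutes[OF the] by auto
      show "map_permutation (range Some) the (map_permutation UNIV Some q) = q"
        if "q \<in> {q. q permutes (UNIV :: 'm set)}" for q
        by (rule map_permutation_compose_inv[OF Some]) (use that in auto)
      show "map_permutation UNIV Some (map_permutation (range Some) the p) = p"
        if "p \<in> {p. p permutes range Some}" for p :: "'m option \<Rightarrow> 'm option"
        by (rule map_permutation_compose_inv[OF the]) (use that in auto)
    qed
  qed
  also have "\<dots> = (\<Sum>q | q permutes UNIV. ?sgn q * (\<Prod>k\<in>UNIV. (a (Some k) - a None) $ q k))"
  proof (intro sum.cong refl)
    fix q :: "'m \<Rightarrow> 'm"
    assume "q \<in> {q. q permutes UNIV}"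
    then have q: "q permutes UNIV"
      by simp
    let ?p = "map_permutation UNIV Some q"
    have p: "?p (Some k) = Some (q k)" "?p None = None" for k
      by (simp add: map_permutation_apply) (simp add: map_permutation_def restrict_id_def)
    have "(\<Prod>i\<in>UNIV. C $ i $ ?p i) = C $ None $ ?p None * (\<Prod>i\<in>range Some. C $ i $ ?p i)"
      by (simp add: UNIV_option_conv)
    also have "\<dots> = (\<Prod>k\<in>UNIV. (a (Some k) - a None) $ q k)"
      by (subst prod.reindex) (simp_all add: p C_None C_Some)
    finally show "?sgn ?p * (\<Prod>i\<in>UNIV. C $ i $ ?p i) = ?sgn q * (\<Prod>k\<in>UNIV. (a (Some k) - a None) $ q k)"
      using sign_map_permutation[OF _ q, of "Some :: 'm \<Rightarrow> 'm option"] by simp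
  qed
  also have "\<dots> = det (\<chi> k l. (a (Some k) - a None) $ l)"
    by (simp add: det_def)
  finally show ?thesis .
qed

section \<open>Gradients and the injectivity of the phase map\<close>

lemma smooth_has_derivative:
  fixes f :: "real^'m::finite \<Rightarrow> real"
  assumes "smooth f"
  shows "(f has_derivative (\<lambda>v. grad f x \<bullet> v)) (at x)"
proof -
  have "Ck (Suc 0) f"
    using assms by (simp add: smooth_def)
  then have "f differentiable at x"
    by simp
  then have f: "(f has_derivative frechet_derivative f (at x)) (at x)"
    by (simp add: frechet_derivative_works)
  have "frechet_derivative f (at x) v = grad f x \<bullet> v" for v
  proof -
    interpret linear "frechet_derivative f (at x)"
      using f by (rule has_derivative_linear)
    have "frechet_derivative f (at x) v = frechet_derivative f (at x) (\<Sum>i\<in>UNIV. v $ i *\<^sub>R axis i 1)"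
      by (simp add: basis_expansion flip: scalar_mult_eq_scaleR)
    also have "\<dots> = grad f x \<bullet> v"
      by (simp add: sum scaleR grad_def inner_vec_def mult.commute)
    finally show ?thesis .
  qed
  then have "frechet_derivative f (at x) = (\<lambda>v. grad f x \<bullet> v)"
    by (rule ext)
  then show ?thesis
    using f by simp
qed

lemma continuous_grad:
  fixes f :: "real^'m::finite \<Rightarrow> real"
  assumes "smooth f"
  shows "continuous_on UNIV (grad f)"
proof -
  have "Ck (Suc 0) f"
    using assms by (simp only: smooth_def)
  then have "continuous_on UNIV (\<lambda>x. frechet_derivative f (at x) (axis i 1))" for i
    by (simp add: axis_in_Basis_iff)
  then show ?thesis
    unfolding grad_def[abs_def] by (intro continuous_on_vec_lambda)
qed

lemma continuous_grad_det:
  fixes \<phi> :: "'m::finite option \<Rightarrow> real^'m \<Rightarrow> real"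
  assumes "\<And>j. smooth (\<phi> j)"
  shows "continuous_on UNIV (grad_det \<phi>)"
proof -
  have "continuous_on UNIV (\<lambda>\<xi>::(real^'m)^('m option). grad (\<phi> j) (\<xi> $ j))" for j
    by (rule continuous_on_compose2[OF continuous_grad[OF assms]]) (auto intro!: continuous_intros)
  then have "continuous_on UNIV (\<lambda>\<xi>::(real^'m)^('m option). case i of None \<Rightarrow> 1 | Some k \<Rightarrow> grad (\<phi> j) (\<xi> $ j) $ k)" for i j
    by (cases i) (auto intro!: continuous_intros)
  then show ?thesis
    unfolding grad_det_def[abs_def] det_def by (auto intro!: continuous_intros)
qed

lemma grad_det_eq:
  "grad_det \<phi> \<xi> = det (\<chi> k l. (grad (\<phi> (Some k)) (\<xi> $ Some k) - grad (\<phi> None) (\<xi> $ None)) $ l)"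
  unfolding grad_det_def by (rule det_bordered)

definition phase_map ::
  "('m::finite option \<Rightarrow> real^'m \<Rightarrow> real) \<Rightarrow> (real^'m)^('m option) \<Rightarrow> ((real^'m) \<times> real)^'m" where
  "phase_map \<phi> \<xi> = (\<chi> k. (\<xi> $ Some k - \<xi> $ None, \<phi> (Some k) (\<xi> $ Some k) - \<phi> None (\<xi> $ None)))"

lemma sum_option: "(\<Sum>j\<in>UNIV. f j) = f None + (\<Sum>k\<in>UNIV. f (Some k))"
  for f :: "'m::finite option \<Rightarrow> 'a::comm_monoid_add"
  by (simp add: UNIV_option_conv sum.reindex)

text \<open>The point with index \<open>None\<close> is minus the sum of the others, so its phase
  spreads over the remaining indices as the subtracted terms of \<open>phase_map\<close>. The total
  phase is thus linear in \<open>y\<close>, which makes the operator a Fourier transform.\<close>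

lemma inner_phase_map:
  fixes y :: "((real^'m) \<times> real)^'m::finite"
  shows "(\<Sum>j\<in>UNIV. fst (zero_sum_point y $ j) \<bullet> \<xi> $ j + snd (zero_sum_point y $ j) * \<phi> j (\<xi> $ j)) =
    y \<bullet> phase_map \<phi> \<xi>"
proof -
  have "fst (\<Sum>k\<in>UNIV. y $ k) = (\<Sum>k\<in>UNIV. fst (y $ k))" "snd (\<Sum>k\<in>UNIV. y $ k) = (\<Sum>k\<in>UNIV. snd (y $ k))"
    by (simp_all add: fst_sum snd_sum)
  then show ?thesis
    by (simp add: sum_option zero_sum_point_def phase_map_def inner_vec_def[of y] inner_prod_def
        inner_diff_right right_diff_distrib sum.distrib sum_subtractf inner_sum_left sum_distrib_left sum_distrib_right
        algebra_simps)
qed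

lemma continuous_phase_map:
  fixes \<phi> :: "'m::finite option \<Rightarrow> real^'m \<Rightarrow> real"
  assumes "\<And>j. smooth (\<phi> j)"
  shows "continuous_on UNIV (phase_map \<phi>)"
proof -
  have "continuous_on UNIV (\<phi> j)" for j
    using assms[of j] has_derivative_continuous[OF smooth_has_derivative[OF assms]]
    by (auto simp: continuous_on_eq_continuous_at)
  then have "continuous_on UNIV (\<lambda>\<xi>::(real^'m)^('m option). \<phi> j (\<xi> $ j))" for j
    by (rule continuous_on_compose2) (auto intro!: continuous_intros)
  then show ?thesis
    unfolding phase_map_def[abs_def] by (intro continuous_intros) auto
qed

text \<open>The mean value theorem provides a separate intermediate point \<open>z j\<close> for
  each \<open>j\<close>. As the determinant hypothesis ranges over independent choices from the
  convex sets \<open>C j\<close>, it applies to this tuple.\<close>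

lemma inj_on_phase_map:
  fixes \<phi> :: "'m::finite option \<Rightarrow> real^'m \<Rightarrow> real"
  assumes smooth: "\<And>j. smooth (\<phi> j)" and C: "\<And>j. convex (C j)"
    and det: "\<And>\<xi>. (\<And>j. \<xi> $ j \<in> C j) \<Longrightarrow> grad_det \<phi> \<xi> \<noteq> 0"
  shows "inj_on (phase_map \<phi>) {\<xi>. \<forall>j. \<xi> $ j \<in> C j}"
proof (rule inj_onI)
  fix \<xi> \<eta> :: "(real^'m)^('m option)"
  assume "\<xi> \<in> {\<xi>. \<forall>j. \<xi> $ j \<in> C j}" "\<eta> \<in> {\<xi>. \<forall>j. \<xi> $ j \<in> C j}"
  then have mem: "\<xi> $ j \<in> C j" "\<eta> $ j \<in> C j" for j
    by auto
  assume eq: "phase_map \<phi> \<xi> = phase_map \<phi> \<eta>"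
  define v where "v = \<xi> $ None - \<eta> $ None"
  define c where "c = \<phi> None (\<xi> $ None) - \<phi> None (\<eta> $ None)"
  have eq': "\<xi> $ Some k - \<xi> $ None = \<eta> $ Some k - \<eta> $ None"
      "\<phi> (Some k) (\<xi> $ Some k) - \<phi> None (\<xi> $ None) = \<phi> (Some k) (\<eta> $ Some k) - \<phi> None (\<eta> $ None)" for k
    using eq unfolding phase_map_def vec_eq_iff by auto
  have v: "\<xi> $ j = \<eta> $ j + v" for j
    using eq'(1) by (cases j) (auto simp: v_def algebra_simps)
  have c: "\<phi> j (\<xi> $ j) - \<phi> j (\<eta> $ j) = c" for j
    using eq'(2) by (cases j) (auto simp: c_def algebra_simps)
  have "\<exists>z. z \<in> C j \<and> grad (\<phi> j) z \<bullet> v = c" for j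
  proof -
    let ?f = "\<lambda>s::real. \<phi> j (\<eta> $ j + s *\<^sub>R v)"
    have "(?f has_derivative (\<lambda>h. grad (\<phi> j) (\<eta> $ j + s *\<^sub>R v) \<bullet> (h *\<^sub>R v))) (at s)" for s
      by (rule has_derivative_compose[OF _ smooth_has_derivative[OF smooth]])
         (auto intro!: derivative_eq_intros)
    then have "DERIV ?f s :> grad (\<phi> j) (\<eta> $ j + s *\<^sub>R v) \<bullet> v" for s
      unfolding has_field_derivative_def
      by (rule has_derivative_eq_rhs) (simp add: fun_eq_iff)
    then obtain s where s: "0 < s" "s < 1" "?f 1 - ?f 0 = (1 - 0) * (grad (\<phi> j) (\<eta> $ j + s *\<^sub>R v) \<bullet> v)"
      using MVT2[of 0 1 ?f "\<lambda>s. grad (\<phi> j) (\<eta> $ j + s *\<^sub>R v) \<bullet> v"] by auto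
    have "\<eta> $ j + s *\<^sub>R v = (1 - s) *\<^sub>R \<eta> $ j + s *\<^sub>R \<xi> $ j"
      by (simp add: v[of j] algebra_simps)
    then have "\<eta> $ j + s *\<^sub>R v \<in> C j"
      using convexD_alt[OF C mem(2) mem(1), of s] s by simp
    then show ?thesis
      using s(3) c[of j] v[of j] by auto
  qed
  then obtain z where z: "z j \<in> C j" "grad (\<phi> j) (z j) \<bullet> v = c" for j
    by metis
  \<comment> \<open>By \<open>grad_det_eq\<close> the determinant of \<open>A\<close> is
    \<open>grad_det\<close> at the tuple \<open>z\<close>, and each row of \<open>A\<close> applied
    to \<open>v\<close> gives \<open>c - c\<close>.\<close>
  define A :: "real^'m^'m" where
    "A = (\<chi> k l. (grad (\<phi> (Some k)) (z (Some k)) - grad (\<phi> None) (z None)) $ l)"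
  have "A *v v = 0"
    using z(2) by (simp add: vec_eq_iff A_def matrix_vector_mult_def inner_vec_def
        left_diff_distrib sum_subtractf)
  moreover have "det A \<noteq> 0"
    using det[of "\<chi> j. z j"] z(1) by (simp add: grad_det_eq A_def)
  ultimately have "v = 0"
    using invertible_det_nz[of A] by (auto simp: invertible_left_inverse matrix_left_invertible_ker)
  then show "\<xi> = \<eta>"
    using v by (simp add: vec_eq_iff)
qed

section \<open>The Jacobian of the phase map\<close>

text \<open>
  Substituting \<open>\<xi>\<^sub>k = w\<^sub>k + t\<close>, \<open>\<xi>\<^sub>n = t\<close> makes the first component of the phase map the identity in
  \<open>w\<close>, so that for its Jacobian only maps \<open>\<real>\<^sup>n\<^sup>-\<^sup>1 \<rightarrow> \<real>\<^sup>n\<^sup>-\<^sup>1\<close> in the variable \<open>t\<close> matter.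
\<close>

definition freq_split :: "((real^'m)^'m) \<times> (real^'m) \<Rightarrow> (real^'m)^('m::finite option)" where
  "freq_split p = (\<chi> j. case j of None \<Rightarrow> snd p | Some k \<Rightarrow> fst p $ k + snd p)"

text \<open>\<open>phase_map\<close> takes its values in vectors of pairs, while the image in
  \<open>emeasure_fibred_image\<close> consists of pairs; this map translates between the two
  shapes.\<close>

definition pair_vec :: "((real^'m)^'m) \<times> (real^'m) \<Rightarrow> ((real^'m) \<times> real)^'m::finite" where
  "pair_vec p = (\<chi> k. (fst p $ k, snd p $ k))"

definition phase_slice ::
  "('m::finite option \<Rightarrow> real^'m \<Rightarrow> real) \<Rightarrow> (real^'m)^'m \<Rightarrow> real^'m \<Rightarrow> real^'m" where
  "phase_slice \<phi> w t = (\<chi> k. \<phi> (Some k) (w $ k + t) - \<phi> None t)"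

lemma phase_map_freq_split:
  "phase_map \<phi> (freq_split p) = pair_vec (fst p, phase_slice \<phi> (fst p) (snd p))"
  by (simp add: phase_map_def freq_split_def pair_vec_def phase_slice_def vec_eq_iff)

lemma bij_freq_split: "bij freq_split"
  by (rule bij_betwI[where g = "\<lambda>\<xi>. (\<chi> k. \<xi> $ Some k - \<xi> $ None, \<xi> $ None)"])
     (auto simp: freq_split_def vec_eq_iff split: option.split)

lemma bij_pair_vec: "bij pair_vec"
  by (rule bij_betwI[where g = "\<lambda>y. (\<chi> k. fst (y $ k), \<chi> k. snd (y $ k))"])
     (auto simp: pair_vec_def vec_eq_iff)

lemma continuous_freq_split: "continuous_on UNIV freq_split"
  unfolding freq_split_def[abs_def]
proof (intro continuous_on_vec_lambda)
  fix j :: "'a option"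
  show "continuous_on UNIV (\<lambda>p::((real^'a)^'a) \<times> (real^'a). case j of None \<Rightarrow> snd p | Some k \<Rightarrow> fst p $ k + snd p)"
    by (cases j) (auto intro!: continuous_intros)
qed

lemma continuous_pair_vec: "continuous_on UNIV pair_vec"
  unfolding pair_vec_def[abs_def] by (intro continuous_intros)

lemma distr_pair_vec: "distr lborel borel pair_vec = (lborel :: (((real^'m) \<times> real)^'m::finite) measure)"
proof (rule lborel_distr_Basis)
  show "linear (pair_vec :: _ \<Rightarrow> ((real^'m) \<times> real)^'m::finite)"
    by (auto simp: linear_iff pair_vec_def vec_eq_iff)
  have pair_vec_axis: "pair_vec (axis k u, 0) = axis k (u, 0)" "pair_vec (0, axis k r) = axis k (0, r)"
    for k and u :: "real^'m" and r
    by (auto simp: pair_vec_def axis_def vec_eq_iff zero_prod_def)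
  have image: "pair_vec ` Basis = (Basis :: (((real^'m) \<times> real)^'m) set)"
  proof (intro subset_antisym subsetI)
    fix x :: "((real^'m) \<times> real)^'m" assume "x \<in> pair_vec ` Basis"
    then obtain b where b: "x = pair_vec b" "b \<in> Basis"
      by auto
    then consider c where "c \<in> Basis" "b = (c, 0)" | c where "c \<in> Basis" "b = (0, c)"
      by (auto simp: Basis_prod_def)
    then show "x \<in> Basis"
    proof cases
      case 1
      then obtain k u where "c = axis k u" "u \<in> Basis"
        by (auto simp: Basis_vec_def[where 'b = 'm and 'a = "real^'m"])
      then show ?thesis
        using b 1 by (simp add: pair_vec_axis axis_in_Basis_iff) (simp add: Basis_prod_def)
    next
      case 2
      then obtain k where "c = axis k 1"
        by (auto simp: Basis_vec_def)
      then show ?thesis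
        using b 2 by (simp add: pair_vec_axis axis_in_Basis_iff) (simp add: Basis_prod_def)
    qed
  next
    fix x :: "((real^'m) \<times> real)^'m" assume "x \<in> Basis"
    then obtain k d where x: "x = axis k d" "d \<in> Basis"
      by (auto simp: Basis_vec_def[where 'b = 'm and 'a = "(real^'m) \<times> real"])
    from x(2) consider u where "u \<in> Basis" "d = (u, 0)" | "d = (0, 1)"
      by (auto simp: Basis_prod_def)
    then show "x \<in> pair_vec ` Basis"
    proof cases
      case 1
      then show ?thesis
        using x by (intro image_eqI[of _ _ "(axis k u, 0)"])
          (simp add: pair_vec_axis, simp add: Basis_prod_def axis_in_Basis_iff)
    next
      case 2
      then show ?thesis
        using x by (intro image_eqI[of _ _ "(0, axis k 1)"])
          (simp add: pair_vec_axis, simp add: Basis_prod_def axis_in_Basis_iff)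
    qed
  qed
  have "inj pair_vec"
    using bij_pair_vec by (rule bij_is_inj)
  then show "bij_betw pair_vec Basis (Basis :: (((real^'m) \<times> real)^'m) set)"
    using image by (auto simp: bij_betw_def intro: inj_on_subset)
qed

text \<open>The substitution is a shear followed by a regrouping of basis vectors. The shear
  preserves volume because for fixed \<open>t\<close> it only translates \<open>w\<close>.\<close>

lemma distr_freq_split: "distr lborel borel freq_split = (lborel :: ((real^'m)^('m::finite option)) measure)"
proof -
  define L :: "((real^'m)^'m) \<times> (real^'m) \<Rightarrow> (real^'m)^('m option)" where
    "L p = (\<chi> j. case j of None \<Rightarrow> snd p | Some k \<Rightarrow> fst p $ k)" for p
  define s :: "((real^'m)^'m) \<times> (real^'m) \<Rightarrow> ((real^'m)^'m) \<times> (real^'m)" where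
    "s p = (fst p + (\<chi> k. snd p), snd p)" for p
  have Ls: "freq_split = L \<circ> s"
    by (auto simp: freq_split_def L_def s_def fun_eq_iff vec_eq_iff split: option.split)
  have L1: "L (axis k u, 0) = axis (Some k) u" for k u
    by (auto simp: L_def axis_def vec_eq_iff split: option.split)
  have L2: "L (0, u) = axis None u" for u
    by (auto simp: L_def axis_def vec_eq_iff split: option.split)
  have "linear L"
    by (auto simp: linear_iff L_def vec_eq_iff split: option.split)
  moreover have "bij_betw L Basis Basis"
  proof -
    have "inj L"
      by (rule inj_on_inverseI[where g = "\<lambda>\<xi>. (\<chi> k. \<xi> $ Some k, \<xi> $ None)"]) (simp add: L_def)
    moreover have "L ` Basis = Basis"
    proof (intro subset_antisym subsetI)
      fix x assume "x \<in> L ` Basis"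
      then obtain b where b: "x = L b" "b \<in> Basis"
        by auto
      then consider c where "c \<in> Basis" "b = (c, 0)" | c where "c \<in> Basis" "b = (0, c)"
        by (auto simp: Basis_prod_def)
      then show "x \<in> Basis"
      proof cases
        case 1
        then obtain k u where "c = axis k u" "u \<in> Basis"
          by (auto simp: Basis_vec_def[where 'b = 'm and 'a = "real^'m"])
        then show ?thesis
          using b 1 by (simp add: L1 axis_in_Basis_iff)
      next
        case 2
        then show ?thesis
          using b by (simp add: L2 axis_in_Basis_iff)
      qed
    next
      fix x :: "(real^'m)^('m option)" assume "x \<in> Basis"
      then obtain j u where x: "x = axis j u" "u \<in> Basis"
        by (auto simp: Basis_vec_def[where 'b = "'m option"])
      show "x \<in> L ` Basis"
      proof (cases j)
        case None
        then show ?thesis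
          using x by (intro image_eqI[of _ _ "(0, u)"]) (auto simp: L2 Basis_prod_def)
      next
        case (Some k)
        then show ?thesis
          using x by (intro image_eqI[of _ _ "(axis k u, 0)"]) (auto simp: L1 Basis_prod_def axis_in_Basis_iff)
      qed
    qed
    ultimately show ?thesis
      by (auto simp: bij_betw_def intro: inj_on_subset)
  qed
  ultimately have L: "distr lborel borel L = lborel"
    by (rule lborel_distr_Basis)
  have L_meas [measurable]: "L \<in> borel_measurable borel"
    using \<open>linear L\<close> by (intro borel_measurable_continuous_onI linear_continuous_on linear_conv_bounded_linear[THEN iffD1])
  have s_meas [measurable]: "s \<in> borel_measurable borel"
    unfolding s_def[abs_def] by (intro borel_measurable_continuous_onI continuous_intros)
  have s: "distr lborel borel s = lborel"
  proof (rule measure_eqI)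
    fix B assume "B \<in> sets (distr lborel borel s)"
    then have B: "B \<in> sets borel"
      by simp
    then have B' [measurable]: "B \<in> sets (borel \<Otimes>\<^sub>M borel)"
      by (simp only: borel_prod)
    have sB: "s -` B \<in> sets (borel \<Otimes>\<^sub>M borel)"
      using measurable_sets[OF s_meas B] by (simp only: borel_prod space_borel Int_UNIV_right)
    have ind: "(\<lambda>p. indicator B p :: ennreal) \<in> borel_measurable (lborel \<Otimes>\<^sub>M lborel)"
      by measurable
    have inds: "(\<lambda>p. indicator B (s p) :: ennreal) \<in> borel_measurable (lborel \<Otimes>\<^sub>M lborel)"
      using sB by (simp add: indicator_vimage[symmetric])
    have slice: "(\<lambda>w. indicator B (w, t) :: ennreal) \<in> borel_measurable borel" for t
      by measurable
    have "emeasure (distr lborel borel s) B = emeasure lborel (s -` B)"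
      using B by (subst emeasure_distr) auto
    also have "\<dots> = (\<integral>\<^sup>+p. indicator B (s p) \<partial>lborel)"
      using measurable_sets[OF s_meas B] by (simp add: indicator_vimage[symmetric])
    also have "\<dots> = (\<integral>\<^sup>+t. \<integral>\<^sup>+w. indicator B (w + (\<chi> k. t), t) \<partial>lborel \<partial>lborel)"
      unfolding lborel_prod[symmetric] by (subst lborel_pair.nn_integral_snd[symmetric, OF inds]) (simp add: s_def)
    also have "\<dots> = (\<integral>\<^sup>+t. \<integral>\<^sup>+w. indicator B (w, t) \<partial>lborel \<partial>lborel)"
      by (intro nn_integral_cong nn_integral_lborel_translate slice)
    also have "\<dots> = (\<integral>\<^sup>+p. indicator B p \<partial>lborel)"
      unfolding lborel_prod[symmetric] by (rule lborel_pair.nn_integral_snd[OF ind])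
    also have "\<dots> = emeasure lborel B"
      using B by simp
    finally show "emeasure (distr lborel borel s) B = emeasure lborel B" .
  qed simp
  have "distr lborel borel freq_split = distr (distr lborel borel s) borel L"
    unfolding Ls by (rule distr_distr[symmetric]) measurable
  then show ?thesis
    by (simp add: s L)
qed

lemma phase_slice_has_derivative:
  assumes "\<And>j. smooth (\<phi> j)"
  shows "(phase_slice \<phi> w has_derivative
    (\<lambda>v. \<chi> k. (grad (\<phi> (Some k)) (w $ k + t) - grad (\<phi> None) t) \<bullet> v)) (at t)"
proof -
  have "((\<lambda>t. \<phi> (Some k) (w $ k + t)) has_derivative (\<lambda>v. grad (\<phi> (Some k)) (w $ k + t) \<bullet> v)) (at t)" for k
    by (rule has_derivative_compose[OF _ smooth_has_derivative[OF assms]]) (auto intro!: derivative_eq_intros)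
  note this[derivative_intros] and smooth_has_derivative[OF assms, derivative_intros]
  show ?thesis
    unfolding phase_slice_def[abs_def]
    by (subst has_derivative_componentwise_within)
       (auto simp: Basis_vec_def inner_axis inner_diff_left intro!: derivative_eq_intros)
qed

text \<open>This supplies the hypothesis \<open>area\<close> of
  \<open>oscillatory_plancherel\<close>. For fixed \<open>w\<close> the derivative in
  \<open>t\<close> is the reduced matrix of \<open>grad_det_eq\<close>, so the Jacobian of the slice
  is exactly \<open>grad_det\<close>.\<close>

lemma emeasure_phase_map_image:
  fixes \<phi> :: "'m::finite option \<Rightarrow> real^'m \<Rightarrow> real"
  assumes smooth: "\<And>j. smooth (\<phi> j)" and S: "closed S" and inj: "inj_on (phase_map \<phi>) S"
    and A: "A \<in> sets borel" "A \<subseteq> S"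
  shows "emeasure lborel (phase_map \<phi> ` A) = (\<integral>\<^sup>+\<xi>. ennreal \<bar>grad_det \<phi> \<xi>\<bar> * indicator A \<xi> \<partial>lborel)"
proof -
  define F where "F p = (fst p, phase_slice \<phi> (fst p) (snd p))" for p
  define Z where "Z = freq_split -` A"
  have [measurable]: "freq_split \<in> borel_measurable borel" "pair_vec \<in> borel_measurable borel"
      "grad_det \<phi> \<in> borel_measurable borel"
    by (intro borel_measurable_continuous_onI continuous_freq_split continuous_pair_vec continuous_grad_det smooth)+
  have image: "phase_map \<phi> ` A \<in> sets borel"
    by (rule borel_injective_image[OF S continuous_on_subset[OF continuous_phase_map[OF smooth]] inj A]) simp
  have Z: "Z \<in> sets borel"
    using measurable_sets[of freq_split borel borel A] A by (simp add: Z_def)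
  have A_eq: "A = freq_split ` Z"
    unfolding Z_def by (rule surj_image_vimage_eq[OF bij_is_surj[OF bij_freq_split], symmetric])
  have "phase_map \<phi> ` A = pair_vec ` F ` Z"
    unfolding A_eq image_image by (simp add: phase_map_freq_split F_def)
  then have FZ: "pair_vec -` phase_map \<phi> ` A = F ` Z"
    using inj_vimage_image_eq[OF bij_is_inj[OF bij_pair_vec]] by metis
  then have FZ_borel: "F ` Z \<in> sets borel"
    using measurable_sets[of pair_vec borel borel "phase_map \<phi> ` A"] image by simp
  define D where "D w t = (\<lambda>v. \<chi> k. (grad (\<phi> (Some k)) (w $ k + t) - grad (\<phi> None) t) \<bullet> v)" for w t
  have det: "det (matrix (D w t)) = grad_det \<phi> (freq_split (w, t))" for w t
    by (simp add: grad_det_eq D_def matrix_def freq_split_def inner_axis)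
  have "emeasure lborel (phase_map \<phi> ` A) = emeasure lborel (F ` Z)"
    using image by (subst distr_pair_vec[symmetric], subst emeasure_distr) (simp_all add: FZ)
  also have "\<dots> = (\<integral>\<^sup>+p. ennreal \<bar>det (matrix (D (fst p) (snd p)))\<bar> * indicator Z p \<partial>lborel)"
    unfolding F_def
  proof (rule emeasure_fibred_image[OF Z])
    show "(\<lambda>p. (fst p, phase_slice \<phi> (fst p) (snd p))) ` Z \<in> sets borel"
      using FZ_borel by (simp add: F_def[abs_def])
    show "(phase_slice \<phi> w has_derivative D w t) (at t)" for w t
      unfolding D_def by (rule phase_slice_has_derivative[OF smooth])
    \<comment> \<open>For a common \<open>w\<close>, equal values of the slice mean equal values of
      \<open>phase_map\<close>, so injectivity descends from \<open>S\<close>.\<close>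
    show "inj_on (phase_slice \<phi> w) {t. (w, t) \<in> Z}" for w
    proof (rule inj_onI)
      fix t t' assume t: "t \<in> {t. (w, t) \<in> Z}" "t' \<in> {t. (w, t) \<in> Z}" "phase_slice \<phi> w t = phase_slice \<phi> w t'"
      then have "phase_map \<phi> (freq_split (w, t)) = phase_map \<phi> (freq_split (w, t'))"
        by (simp add: phase_map_freq_split)
      then have "freq_split (w, t) = freq_split (w, t')"
        using inj t A(2) by (auto simp: Z_def dest: inj_onD)
      then show "t = t'"
        using bij_is_inj[OF bij_freq_split] by (auto dest: injD)
    qed
    show "(\<lambda>p. \<bar>det (matrix (D (fst p) (snd p)))\<bar>) \<in> borel_measurable borel"
      unfolding det prod.collapse by measurable
  qed
  also have "\<dots> = (\<integral>\<^sup>+p. ennreal \<bar>grad_det \<phi> (freq_split p)\<bar> * indicator A (freq_split p) \<partial>lborel)"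
    by (simp add: det Z_def indicator_def)
  also have "\<dots> = (\<integral>\<^sup>+\<xi>. ennreal \<bar>grad_det \<phi> \<xi>\<bar> * indicator A \<xi> \<partial>lborel)"
    using A by (subst distr_freq_split[symmetric], subst nn_integral_distr) simp_all
  finally show ?thesis .
qed

section \<open>Essential supports and the passage to Borel representatives\<close>

lemma closed_ess_support: "closed (ess_support f)"
  unfolding ess_support_def by (auto intro!: open_Union)

text \<open>The open sets in the definition form an uncountable family, and an uncountable union of
  null sets need not be null; Lindelof's theorem gives a countable subfamily with the same
  union.\<close>

lemma AE_ess_support:
  fixes f :: "'a::euclidean_space \<Rightarrow> 'b::zero"
  shows "AE x in lebesgue. f x \<noteq> 0 \<longrightarrow> x \<in> ess_support f"
proof -
  let ?\<U> = "{U. open U \<and> (AE x in lebesgue. x \<in> U \<longrightarrow> f x = 0)}"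
  obtain \<U> where \<U>: "\<U> \<subseteq> ?\<U>" "countable \<U>" "\<Union>\<U> = \<Union>?\<U>"
    using Lindelof[of ?\<U>] by auto
  have "AE x in lebesgue. \<forall>U\<in>\<U>. x \<in> U \<longrightarrow> f x = 0"
    using \<U> by (subst AE_ball_countable) auto
  then show ?thesis
  proof eventually_elim
    case (elim x)
    then have "f x \<noteq> 0 \<longrightarrow> x \<notin> \<Union>\<U>"
      by auto
    then show ?case
      unfolding \<U>(3) ess_support_def by auto
  qed
qed

lemma borel_version_complex:
  fixes f :: "'a \<Rightarrow> complex"
  assumes [measurable]: "f \<in> borel_measurable (completion M)"
  obtains f' where "f' \<in> borel_measurable M" "AE x in M. f x = f' x"
proof -
  obtain u where u [measurable]: "u \<in> borel_measurable M" "AE x in M. Re (f x) = u x"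
    using completion_ex_borel_measurable_real[of "\<lambda>x. Re (f x)" M] by auto
  obtain v where v [measurable]: "v \<in> borel_measurable M" "AE x in M. Im (f x) = v x"
    using completion_ex_borel_measurable_real[of "\<lambda>x. Im (f x)" M] by auto
  show thesis
  proof
    show "(\<lambda>x. Complex (u x) (v x)) \<in> borel_measurable M"
      unfolding Complex_eq by measurable
    show "AE x in M. f x = Complex (u x) (v x)"
      using u(2) v(2) by eventually_elim (simp add: complex_eq_iff)
  qed
qed

text \<open>\<open>T_defined\<close> does not follow from the integrability of the
  \<open>g j\<close>, since the weight may be unbounded on the product of the supports; without
  absolute convergence the Bochner integral would be 0 by convention.\<close>

theorem theorem1p3:
  fixes \<phi> :: "'m::finite option \<Rightarrow> real^'m \<Rightarrow> real"
    and g :: "'m option \<Rightarrow> real^'m \<Rightarrow> complex"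
    and \<sigma> :: real
  assumes smooth_phi: "\<And>j. smooth (\<phi> j)"
    and g_L1: "\<And>j. integrable lebesgue (g j)"
    and T_defined: "\<And>x. integrable lebesgue (T_integrand \<sigma> \<phi> g x)"
    and det_nonzero: "\<And>\<xi>. (\<And>j. \<xi> $ j \<in> convex hull (ess_support (g j))) \<Longrightarrow> grad_det \<phi> \<xi> \<noteq> 0"
  shows "(\<integral>\<^sup>+ y. ennreal ((cmod (T_op \<sigma> \<phi> g (zero_sum_point y)))\<^sup>2) \<partial>lebesgue) =
         ennreal ((2 * pi) ^ (CARD('m option) * (CARD('m option) - 1))) *
         (\<integral>\<^sup>+ \<xi>. ennreal ((\<Prod>j\<in>UNIV. (cmod (g j (\<xi> $ j)))\<^sup>2) / \<bar>grad_det \<phi> \<xi>\<bar> powr (1 - 2 * \<sigma>)) \<partial>lebesgue)"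
proof -
  define S where "S = {\<xi>::(real^'m)^('m option). \<forall>j. \<xi> $ j \<in> ess_support (g j)}"
  have "S = (\<Inter>j. (\<lambda>\<xi>. \<xi> $ j) -` ess_support (g j))"
    by (auto simp: S_def)
  then have S: "closed S"
    by (auto intro!: closed_INT continuous_closed_vimage closed_ess_support)
  then have [measurable]: "S \<in> sets borel"
    by simp
  have det: "\<bar>grad_det \<phi> \<xi>\<bar> > 0" if "\<xi> \<in> S" for \<xi>
  proof -
    have "grad_det \<phi> \<xi> \<noteq> 0"
      using that by (intro det_nonzero hull_inc) (simp add: S_def)
    then show ?thesis
      by simp
  qed
  have inj: "inj_on (phase_map \<phi>) S"
  proof (rule inj_on_subset)
    show "inj_on (phase_map \<phi>) {\<xi>. \<forall>j. \<xi> $ j \<in> convex hull (ess_support (g j))}"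
      by (rule inj_on_phase_map) (rule smooth_phi convex_convex_hull det_nonzero | assumption)+
  qed (auto simp: S_def intro: hull_inc)
  have det_meas [measurable]: "grad_det \<phi> \<in> borel_measurable borel"
    by (intro borel_measurable_continuous_onI continuous_grad_det smooth_phi)
  have [measurable]: "phase_map \<phi> \<in> borel_measurable borel"
    by (intro borel_measurable_continuous_onI continuous_phase_map smooth_phi)

  define h where "h \<xi> = complex_of_real (\<bar>grad_det \<phi> \<xi>\<bar> powr \<sigma>) * (\<Prod>j\<in>UNIV. g j (\<xi> $ j))" for \<xi>
  have "T_integrand \<sigma> \<phi> g 0 = h"
    by (simp add: T_integrand_def h_def fun_eq_iff)
  \<comment> \<open>At the origin all exponentials are 1, so the integrability of the weighted
    product is an instance of \<open>T_defined\<close>.\<close>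
  with T_defined[of 0] have h_int: "integrable lebesgue h"
    by simp
  have h_S: "AE \<xi> in lborel. h \<xi> \<noteq> 0 \<longrightarrow> \<xi> \<in> S"
  proof -
    have "AE \<xi> in (lborel :: ((real^'m)^('m option)) measure). g j (\<xi> $ j) \<noteq> 0 \<longrightarrow> \<xi> $ j \<in> ess_support (g j)" for j
      using AE_ess_support[of "g j"] by (intro AE_lborel_component) (simp only: AE_completion_iff)
    then have "AE \<xi> in (lborel :: ((real^'m)^('m option)) measure).
        \<forall>j\<in>UNIV. g j (\<xi> $ j) \<noteq> 0 \<longrightarrow> \<xi> $ j \<in> ess_support (g j)"
      by (intro AE_finite_allI) auto
    then show ?thesis
      by eventually_elim (auto simp: h_def S_def)
  qed
  \<comment> \<open>\<open>h\<close> is Lebesgue measurable and vanishes off \<open>S\<close> only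
    almost everywhere, whereas \<open>oscillatory_plancherel\<close> asks for a Borel function that
    vanishes there at every point; \<open>h0\<close> is such a representative.\<close>
  obtain h1 where h1 [measurable]: "h1 \<in> borel_measurable lborel" "AE \<xi> in lborel. h \<xi> = h1 \<xi>"
    using borel_version_complex[OF borel_measurable_integrable[OF h_int]] by blast
  define h0 where "h0 \<xi> = indicator S \<xi> *\<^sub>R h1 \<xi>" for \<xi>
  have h0 [measurable]: "h0 \<in> borel_measurable borel"
    using h1 unfolding h0_def[abs_def] by measurable
  have h_h0: "AE \<xi> in lborel. h \<xi> = h0 \<xi>"
    using h_S h1(2) by eventually_elim (auto simp: h0_def split: split_indicator)
  have h_h0': "AE \<xi> in lebesgue. h \<xi> = h0 \<xi>"
    using h_h0 by (rule AE_completion)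
  have "integrable lebesgue h0"
    by (rule integrable_cong_AE_imp[OF h_int _ h_h0'])
       (rule measurable_completion, use h0 in simp)
  then have h0_int: "integrable lborel h0"
    by (subst (asm) integrable_completion) auto

  have T: "T_op \<sigma> \<phi> g (zero_sum_point y) =
      (\<integral>\<xi>. h0 \<xi> * exp (\<i> * complex_of_real (y \<bullet> phase_map \<phi> \<xi>)) \<partial>lborel)" for y
  proof -
    have T_eq: "T_integrand \<sigma> \<phi> g (zero_sum_point y) \<xi> =
        h \<xi> * exp (\<i> * complex_of_real (y \<bullet> phase_map \<phi> \<xi>))" for \<xi>
    proof -
      have "exp (\<i> * complex_of_real (y \<bullet> phase_map \<phi> \<xi>)) =
          (\<Prod>j\<in>UNIV. exp (\<i> * complex_of_real (fst (zero_sum_point y $ j) \<bullet> \<xi> $ j + snd (zero_sum_point y $ j) * \<phi> j (\<xi> $ j))))"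
        unfolding inner_phase_map[symmetric]
        by (simp only: of_real_sum sum_distrib_left exp_sum[OF finite])
      then show ?thesis
        by (simp only: T_integrand_def h_def prod.distrib ac_simps)
    qed
    have "T_op \<sigma> \<phi> g (zero_sum_point y) =
        (\<integral>\<xi>. h0 \<xi> * exp (\<i> * complex_of_real (y \<bullet> phase_map \<phi> \<xi>)) \<partial>lebesgue)"
      unfolding T_op_def
    proof (rule integral_cong_AE)
      show "T_integrand \<sigma> \<phi> g (zero_sum_point y) \<in> borel_measurable lebesgue"
        using T_defined by (rule borel_measurable_integrable)
      show "(\<lambda>\<xi>. h0 \<xi> * exp (\<i> * complex_of_real (y \<bullet> phase_map \<phi> \<xi>))) \<in> borel_measurable lebesgue"
        by (rule measurable_completion) measurable
      show "AE \<xi> in lebesgue. T_integrand \<sigma> \<phi> g (zero_sum_point y) \<xi> =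
          h0 \<xi> * exp (\<i> * complex_of_real (y \<bullet> phase_map \<phi> \<xi>))"
        using h_h0' by eventually_elim (simp add: T_eq)
    qed
    also have "\<dots> = (\<integral>\<xi>. h0 \<xi> * exp (\<i> * complex_of_real (y \<bullet> phase_map \<phi> \<xi>)) \<partial>lborel)"
      by (rule integral_completion) measurable
    finally show ?thesis .
  qed
  have "(\<integral>\<^sup>+ y. ennreal ((cmod (T_op \<sigma> \<phi> g (zero_sum_point y)))\<^sup>2) \<partial>lebesgue) =
      (\<integral>\<^sup>+y. ennreal ((cmod (\<integral>\<xi>. h0 \<xi> * exp (\<i> * complex_of_real (y \<bullet> phase_map \<phi> \<xi>)) \<partial>lborel))\<^sup>2) \<partial>lborel)"
    by (simp only: T nn_integral_completion)
  also have "\<dots> = ennreal ((2 * pi) ^ DIM(((real^'m) \<times> real)^'m)) *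
      (\<integral>\<^sup>+\<xi>. ennreal ((cmod (h0 \<xi>))\<^sup>2 / \<bar>grad_det \<phi> \<xi>\<bar>) \<partial>lborel)"
  proof (rule oscillatory_plancherel[OF S continuous_phase_map[OF smooth_phi] inj])
    show "(\<lambda>\<xi>. \<bar>grad_det \<phi> \<xi>\<bar>) \<in> borel_measurable borel"
      by measurable
    show "emeasure lborel (phase_map \<phi> ` A) = (\<integral>\<^sup>+\<xi>. ennreal \<bar>grad_det \<phi> \<xi>\<bar> * indicator A \<xi> \<partial>lborel)"
      if "A \<in> sets borel" "A \<subseteq> S" for A
      by (rule emeasure_phase_map_image[OF smooth_phi S inj that])
    show "h0 \<xi> = 0" if "\<xi> \<notin> S" for \<xi>
      using that by (simp add: h0_def)
  qed (fact det h0_int)+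
  \<comment> \<open>\<open>'m\<close> has \<open>n - 1\<close> elements, and each entry of the
    vector has dimension \<open>n\<close>.\<close>
  also have "DIM(((real^'m) \<times> real)^'m) = CARD('m option) * (CARD('m option) - 1)"
    by simp
  also have "(\<integral>\<^sup>+\<xi>. ennreal ((cmod (h0 \<xi>))\<^sup>2 / \<bar>grad_det \<phi> \<xi>\<bar>) \<partial>lborel) =
      (\<integral>\<^sup>+ \<xi>. ennreal ((\<Prod>j\<in>UNIV. (cmod (g j (\<xi> $ j)))\<^sup>2) / \<bar>grad_det \<phi> \<xi>\<bar> powr (1 - 2 * \<sigma>)) \<partial>lborel)"
  proof (rule nn_integral_cong_AE, use h_h0 in eventually_elim)
    fix \<xi> assume h: "h \<xi> = h0 \<xi>"
    have norm_h: "(cmod (h \<xi>))\<^sup>2 = (\<bar>grad_det \<phi> \<xi>\<bar> powr \<sigma>)\<^sup>2 * (\<Prod>j\<in>UNIV. (cmod (g j (\<xi> $ j)))\<^sup>2)"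
      by (simp add: h_def norm_mult power_mult_distrib prod_power_distrib flip: prod_norm)
    have "(cmod (h0 \<xi>))\<^sup>2 / \<bar>grad_det \<phi> \<xi>\<bar> =
        (\<Prod>j\<in>UNIV. (cmod (g j (\<xi> $ j)))\<^sup>2) / \<bar>grad_det \<phi> \<xi>\<bar> powr (1 - 2 * \<sigma>)"
    \<comment> \<open>Where the determinant vanishes, both quotients are 0 by the conventions
      \<open>0 powr a = 0\<close> and \<open>x / 0 = 0\<close>.\<close>
    proof (cases "grad_det \<phi> \<xi> = 0")
      case False
      have "\<bar>grad_det \<phi> \<xi>\<bar> powr (1 - 2 * \<sigma>) = \<bar>grad_det \<phi> \<xi>\<bar> / (\<bar>grad_det \<phi> \<xi>\<bar> powr \<sigma>)\<^sup>2"
        using powr_diff[of "\<bar>grad_det \<phi> \<xi>\<bar>" 1 "2 * \<sigma>"] powr_add[of "\<bar>grad_det \<phi> \<xi>\<bar>" \<sigma> \<sigma>]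
        by (simp add: power2_eq_square)
      then show ?thesis
        unfolding h[symmetric] norm_h by simp
    qed simp
    then show "ennreal ((cmod (h0 \<xi>))\<^sup>2 / \<bar>grad_det \<phi> \<xi>\<bar>) =
        ennreal ((\<Prod>j\<in>UNIV. (cmod (g j (\<xi> $ j)))\<^sup>2) / \<bar>grad_det \<phi> \<xi>\<bar> powr (1 - 2 * \<sigma>))"
      by simp
  qed
  finally show ?thesis
    by (simp only: nn_integral_completion)
qed

end
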